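(* Let $T^l_1,\dots,T^l_m$ be all alternating well-structured graphs on the vertex set $[n]$. Then $\mathcal{P}(T^l_1),\dots,\mathcal{P}(T^l_m)$ are $n$-dimensional simplices forming a triangulation of $\mathcal{P}(C_n^+)$. Furthermore, $$\operatorname{vol}_n(\mathcal{P}(C_n^+))=\binom{2n-1}{n}\frac{2}{n!}.$$
   Context: A signed graph on $[n]=\{1,\dots,n\}$ is a finite multigraph (loops allowed) with each edge labeled $+$ or $-$; all loops are labeled $+$. An edge with endpoints $i,j$ and sign $\epsilon$ is written $(i,j,\epsilon)=(j,i,\epsilon)$. A positive edge is incident with a positive sign to both endpoints; a negative edge is incident with a positive sign to its smaller endpoint and with a negative sign to its larger one. A graph is alternating if at every vertex all incident edges are incident with the same sign. A graph $H$ on $[n]$ is well-structured if: (i) $H$ is noncrossing, i.e. there are no $i<j<k<l$ with edges $(i,k,\epsilon_1),(j,l,\epsilon_2)$ of $H$; (ii) for any edges $(i,j,+),(k,l,+)$ with $i<j$, $k<l$: $i<l$ and $k<j$; (iii) for any edges $(i,i,+),(k,l,+)$ with $k<l$: $k\le i\le l$; (iv) there are no edges $(i,i,+),(k,j,-)$ with $k<i<j$; (v) there are no edges $(i,j,+),(k,l,-)$ with $k\le i<j\le l$; (vi) $H$ is connected, contains exactly one loop, and contains no nonloop cycles. Let $e_1,\dots,e_n$ be the standard basis of $\mathbb{R}^n$. For $i\le j$ put $\mathrm{v}(i,j,-)=e_i-e_j$ (here $i<j$) and $\mathrm{v}(i,j,+)=e_i+e_j$ (so $\mathrm{v}(i,i,+)=2e_i$).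 Let $\Phi^+=\{e_i-e_j,\ e_i+e_j,\ 2e_k : 1\le i<j\le n,\ k\in[n]\}$. The cone $\mathcal{C}(G)$ is the set of nonnegative linear combinations of the vectors $\mathrm{v}(e)$, $e\in E(G)$; $\mathcal{P}(G)=\operatorname{ConvHull}(\{0\}\cup(\Phi^+\cap\mathcal{C}(G)))$; and $\mathcal{P}(C_n^+)=\operatorname{ConvHull}(\{0\}\cup\Phi^+)$. A (central) triangulation of a $d$-dimensional root polytope $\mathcal{P}(G)$ is a collection of $d$-dimensional simplices with pairwise disjoint interiors whose union is $\mathcal{P}(G)$, each having the origin as a vertex and all its other vertices in $\Phi^+\cap\mathcal{C}(G)$. ($\mathcal{P}(C_n^+)=\mathcal{P}(P^l)$ for the graph $P^l$ with edges $(n,n,+)$ and $(i,i+1,-)$, $i\in[n-1]$, for which $\Phi^+\cap\mathcal{C}(P^l)=\Phi^+$.) $\operatorname{vol}_n$ is $n$-dimensional Euclidean volume. *)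

theory Defs
  imports "HOL-Analysis.Analysis" "HOL-Library.Multiset" "HOL-Library.Disjoint_Sets"
begin

datatype edge_sign = Positive | Negative

(* The edge (i,j,s) = (j,i,s) is stored with its endpoints in increasing order, i \<le> j.
   A multigraph is the multiset of its edges, so parallel edges (with equal or with
   different signs) are allowed; the vertex set is given separately. *)

type_synonym 'v sedge = "'v \<times> 'v \<times> edge_sign"

type_synonym 'v sgraph = "'v sedge multiset"

definition signed_graph :: "'v::linorder set \<Rightarrow> 'v sgraph \<Rightarrow> bool" where
  "signed_graph V H \<longleftrightarrow>
     (\<forall>(i, j, s) \<in> set_mset H. i \<in> V \<and> j \<in> V \<and> i \<le> j \<and> (i = j \<longrightarrow> s = Positive))"

fun incident :: "'v sedge \<Rightarrow> 'v \<Rightarrow> bool" where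
  "incident (i, j, s) v \<longleftrightarrow> v = i \<or> v = j"

fun incidence_sign :: "'v sedge \<Rightarrow> 'v \<Rightarrow> edge_sign" where
  "incidence_sign (i, j, s) v = (if s = Negative \<and> v = j then Negative else Positive)"

definition alternating :: "'v sgraph \<Rightarrow> bool" where
  "alternating H \<longleftrightarrow>
     (\<forall>v. \<forall>e \<in> set_mset H. \<forall>f \<in> set_mset H.
        incident e v \<and> incident f v \<longrightarrow> incidence_sign e v = incidence_sign f v)"

fun joins :: "'v sedge \<Rightarrow> 'v \<Rightarrow> 'v \<Rightarrow> bool" where
  "joins (i, j, s) u v \<longleftrightarrow> (u = i \<and> v = j) \<or> (u = j \<and> v = i)"

definition connected_graph :: "'v set \<Rightarrow> 'v sgraph \<Rightarrow> bool" where
  "connected_graph V H \<longleftrightarrow>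
     (\<forall>u \<in> V. \<forall>v \<in> V. (u, v) \<in> {(x, y). \<exists>e \<in> set_mset H. joins e x y}\<^sup>*)"

(* The condition mset es \<subseteq># H makes the edges of the cycle distinct as edges of the
   multigraph: two parallel edges form a cycle of length 2, but no edge forms one with itself.
   Loops are excluded because vs is distinct of length at least 2. *)

definition nonloop_cycle :: "'v sgraph \<Rightarrow> 'v list \<Rightarrow> 'v sedge list \<Rightarrow> bool" where
  "nonloop_cycle H vs es \<longleftrightarrow>
     2 \<le> length vs \<and> distinct vs \<and> length es = length vs \<and> mset es \<subseteq># H \<and>
     (\<forall>k < length vs. joins (es ! k) (vs ! k) (vs ! (Suc k mod length vs)))"

definition noncrossing :: "'v::linorder sgraph \<Rightarrow> bool" where
  "noncrossing H \<longleftrightarrow>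
     \<not> (\<exists>i j k l s t. i < j \<and> j < k \<and> k < l \<and> (i, k, s) \<in># H \<and> (j, l, t) \<in># H)"

definition well_structured :: "'v::linorder set \<Rightarrow> 'v sgraph \<Rightarrow> bool" where
  "well_structured V H \<longleftrightarrow>
     signed_graph V H \<and>
     noncrossing H \<and>
     (\<forall>i j k l. (i, j, Positive) \<in># H \<and> (k, l, Positive) \<in># H \<and> i < j \<and> k < l
        \<longrightarrow> i < l \<and> k < j) \<and>
     (\<forall>i k l. (i, i, Positive) \<in># H \<and> (k, l, Positive) \<in># H \<and> k < l \<longrightarrow> k \<le> i \<and> i \<le> l) \<and>
     \<not> (\<exists>i k j. (i, i, Positive) \<in># H \<and> (k, j, Negative) \<in># H \<and> k < i \<and> i < j) \<and>
     \<not> (\<exists>i j k l. (i, j, Positive) \<in># H \<and> (k, l, Negative) \<in># H \<and> k \<le> i \<and> i < j \<and> j \<le> l) \<and>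
     connected_graph V H \<and>
     size {#(i, j, s) \<in># H. i = j#} = 1 \<and>
     \<not> (\<exists>vs es. nonloop_cycle H vs es)"

(* The index type 'n of real^'n plays the role of [n] = {1,...,n}, with n = CARD('n):
   a finite well-order is determined up to unique order isomorphism by its cardinality,
   and every n \<ge> 1 occurs as such a cardinality. Graphs on [n] have vertex set UNIV :: 'n set. *)

fun edge_vector :: "'n::finite sedge \<Rightarrow> real^'n" where
  "edge_vector (i, j, Negative) = axis i 1 - axis j 1"
| "edge_vector (i, j, Positive) = axis i 1 + axis j 1"

definition positive_roots :: "(real^'n::{finite,linorder}) set" where
  "positive_roots =
     {axis i 1 - axis j 1 | i j. i < j} \<union> {axis i 1 + axis j 1 | i j. i < j} \<union>
     {2 *\<^sub>R axis k 1 | k. True}"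

definition graph_cone :: "'n::finite sgraph \<Rightarrow> (real^'n::_) set" where
  "graph_cone G =
     {\<Sum>e\<in>set_mset G. c e *\<^sub>R edge_vector e | c. \<forall>e \<in> set_mset G. 0 \<le> c e}"

definition root_polytope :: "'n::{finite,linorder} sgraph \<Rightarrow> (real^'n::_) set" where
  "root_polytope G = convex hull (insert 0 (positive_roots \<inter> graph_cone G))"

definition full_root_polytope :: "(real^'n::{finite,linorder}) set" where
  "full_root_polytope = convex hull (insert 0 positive_roots)"

(* Triangulation of the polytope convex hull (insert 0 R) by the indexed family S i, i in I.
   Taking R = positive_roots \<inter> graph_cone G gives the triangulations of root_polytope G, and
   R = positive_roots gives those of full_root_polytope.  The interior of a d-dimensional simplex
   is its relative interior, which is the topological one when d is the dimension of the space. *)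

definition central_triangulation ::
  "'a::euclidean_space set \<Rightarrow> 'i set \<Rightarrow> ('i \<Rightarrow> 'a set) \<Rightarrow> bool" where
  "central_triangulation R I S \<longleftrightarrow>
     finite I \<and>
     (\<forall>i \<in> I. aff_dim (convex hull (insert 0 R)) simplex S i \<and>
              0 extreme_point_of S i \<and>
              (\<forall>x. x extreme_point_of S i \<longrightarrow> x = 0 \<or> x \<in> R)) \<and>
     disjoint_family_on (\<lambda>i. rel_interior (S i)) I \<and>
     (\<Union>i \<in> I. S i) = convex hull (insert 0 R)"

end

theory Submission
  imports Defs "HOL-Combinatorics.Multiset_Permutations"
begin

text \<open>
  A vector $x$ lies in the cone over all positive roots iff its prefix sums are nonnegative. Such a vector
  is a nonnegative combination, in exactly one way, of edge vectors whose edges satisfy the structural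
  conditions: a greedy choice of one edge at a time proves existence and uniqueness at once. Uniqueness
  yields linear independence of the edge vectors of $T^l_i$, the fact that the cone of $T^l_i$ contains no
  further roots, and disjointness of interiors. Alternation excludes cancellation, so the weights sum
  to half the $l^1$-norm of $x$; hence the polytope consists of the vectors with nonnegative prefix sums
  and $l^1$-norm at most 2. If no nontrivial combination of the coordinates of $x$ with coefficients
  $-1, 0, 1$ vanishes, the edges used by $x$ form a connected graph with a loop, and a dimension count
  excludes cycles. Such vectors are dense, so the simplices cover the polytope.

  For the volume, average over all signed permutations of the coordinates: a generic vector has
  $(2n-1)!!$ signed rearrangements with positive prefix sums (Sparre Andersen). Cutting an arbitrary
  signed arrangement where its prefix sums are maximal gives the convolution identity that determines
  this number.
\<close>

section \<open>Admissible edge sets\<close>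

text \<open>Connectedness and having a loop are lost when edges are deleted, while the greedy
  induction works by adding and removing single edges. These conditions are therefore kept out of
  the theory of representations and recovered only for generic vectors. Two simplices never have to
  be compared geometrically: a point in the relative interior of a simplex has the whole graph as
  its support, and the support is a function of the point.

  The volume does not come from counting the graphs, although each simplex has volume 2/n! and the
  binomial coefficient is their number. It uses only the description by inequalities: the l^1 ball
  of radius 2 has volume 4^n/n! and is invariant under signed permutations, and the proportion of it
  with nonnegative prefix sums is binom(2n,n)/4^n, the probability familiar from one-dimensional
  walks. The product binom(2n,n)/n! is the stated value since binom(2n,n) = 2 binom(2n-1,n).\<close>

text \<open>What remains of being alternating and well-structured without connectedness, acyclicity and the
  existence of a loop; this passes to subsets of the edge set.\<close>

definition admissible :: "'v::linorder sedge set \<Rightarrow> bool" where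
  "admissible E \<longleftrightarrow>
     (\<forall>i j s. (i, j, s) \<in> E \<longrightarrow> i \<le> j \<and> (i = j \<longrightarrow> s = Positive)) \<and>
     (\<forall>v. \<forall>e \<in> E. \<forall>f \<in> E. incident e v \<and> incident f v \<longrightarrow> incidence_sign e v = incidence_sign f v) \<and>
     (\<forall>i j k l s t. (i, k, s) \<in> E \<and> (j, l, t) \<in> E \<longrightarrow> \<not> (i < j \<and> j < k \<and> k < l)) \<and>
     (\<forall>i j k l. (i, j, Positive) \<in> E \<and> (k, l, Positive) \<in> E \<and> i < j \<and> k < l \<longrightarrow> i < l \<and> k < j) \<and>
     (\<forall>i k l. (i, i, Positive) \<in> E \<and> (k, l, Positive) \<in> E \<and> k < l \<longrightarrow> k \<le> i \<and> i \<le> l) \<and>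
     (\<forall>i k j. (i, i, Positive) \<in> E \<and> (k, j, Negative) \<in> E \<longrightarrow> \<not> (k < i \<and> i < j)) \<and>
     (\<forall>i j k l. (i, j, Positive) \<in> E \<and> (k, l, Negative) \<in> E \<longrightarrow> \<not> (k \<le> i \<and> i < j \<and> j \<le> l)) \<and>
     (\<forall>i k. (i, i, Positive) \<in> E \<and> (k, k, Positive) \<in> E \<longrightarrow> i = k)"

lemma admissible_edge:
  assumes "admissible E" "(i, j, s) \<in> E"
  shows "i \<le> j" "i = j \<Longrightarrow> s = Positive"
  using assms(2) assms(1)[unfolded admissible_def, THEN conjunct1] by blast+

lemma admissible_alternating:
  assumes "admissible E" "e \<in> E" "f \<in> E" "incident e v" "incident f v"
  shows "incidence_sign e v = incidence_sign f v"
  using assms(2-) assms(1)[unfolded admissible_def, THEN conjunct2, THEN conjunct1] by blast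

lemma admissible_noncrossing:
  assumes "admissible E" "(i, k, s) \<in> E" "(j, l, t) \<in> E" "i < j" "j < k"
  shows "l \<le> k"
  using assms(2-)
    assms(1)[unfolded admissible_def, THEN conjunct2, THEN conjunct2, THEN conjunct1]
  by (meson not_le)

lemma admissible_Positive:
  assumes "admissible E" "(i, j, Positive) \<in> E" "(k, l, Positive) \<in> E" "i < j" "k < l"
  shows "i < l" "k < j"
  using assms(2-) assms(1)[unfolded admissible_def, THEN conjunct2, THEN conjunct2,
      THEN conjunct2, THEN conjunct1]
  by blast+

lemma admissible_loop_Positive:
  assumes "admissible E" "(i, i, Positive) \<in> E" "(k, l, Positive) \<in> E" "k < l"
  shows "k \<le> i" "i \<le> l"
  using assms(2-) assms(1)[unfolded admissible_def, THEN conjunct2, THEN conjunct2,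
      THEN conjunct2, THEN conjunct2, THEN conjunct1]
  by blast+

lemma admissible_loop_Negative:
  assumes "admissible E" "(i, i, Positive) \<in> E" "(k, j, Negative) \<in> E" "k < i"
  shows "j \<le> i"
  using assms(2-) assms(1)[unfolded admissible_def, THEN conjunct2, THEN conjunct2,
      THEN conjunct2, THEN conjunct2, THEN conjunct2, THEN conjunct1]
  by (meson not_le)

lemma admissible_Positive_Negative:
  assumes "admissible E" "(i, j, Positive) \<in> E" "(k, l, Negative) \<in> E" "k \<le> i" "i < j"
  shows "l < j"
  using assms(2-) assms(1)[unfolded admissible_def, THEN conjunct2, THEN conjunct2,
      THEN conjunct2, THEN conjunct2, THEN conjunct2, THEN conjunct2, THEN conjunct1]
  by (meson not_le)

lemma admissible_loop_unique:
  assumes "admissible E" "(i, i, Positive) \<in> E" "(k, k, Positive) \<in> E"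
  shows "i = k"
  using assms(2-) assms(1)[unfolded admissible_def, THEN conjunct2, THEN conjunct2,
      THEN conjunct2, THEN conjunct2, THEN conjunct2, THEN conjunct2, THEN conjunct2]
  by blast

lemma admissible_subset:
  assumes E: "admissible E" and F: "F \<subseteq> E"
  shows "admissible F"
  unfolding admissible_def
proof (intro conjI allI impI ballI, goal_cases)
  case 1 then show ?case using admissible_edge(1)[OF E] F by (meson subsetD)
next
  case (2 i j s) then show ?case using admissible_edge(2)[OF E subsetD[OF F], of i i s] by blast
next
  case 3 then show ?case using admissible_alternating[OF E] F by (meson subsetD)
next
  case 4 then show ?case using admissible_noncrossing[OF E] F by (meson not_le subsetD)
next
  case 5 then show ?case using admissible_Positive(1)[OF E] F by (meson subsetD)
next
  case 6 then show ?case using admissible_Positive(2)[OF E] F by (meson subsetD)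
next
  case 7 then show ?case using admissible_loop_Positive(1)[OF E] F by (meson subsetD)
next
  case 8 then show ?case using admissible_loop_Positive(2)[OF E] F by (meson subsetD)
next
  case 9 then show ?case using admissible_loop_Negative[OF E] F by (meson not_le subsetD)
next
  case 10 then show ?case using admissible_Positive_Negative[OF E] F by (meson not_le subsetD)
next
  case 11 then show ?case using admissible_loop_unique[OF E] F by (meson subsetD)
qed

lemma finite_sedge [simp]: "finite (E :: 'n::finite sedge set)"
proof -
  have U: "(UNIV :: edge_sign set) = {Positive, Negative}"
    using edge_sign.exhaust by auto
  have "finite (UNIV :: edge_sign set)" unfolding U by simp
  then have "finite (UNIV :: 'n sedge set)" by (intro finite_Prod_UNIV finite_class.finite_UNIV)
  then show ?thesis by (rule rev_finite_subset) simp
qed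

section \<open>Weighted representations and their sign pattern\<close>

lemma edge_vector_nth:
  "edge_vector (i, j, s) $ v =
    (if v = i then 1 else 0) + (if v = j then (if s = Negative then -1 else 1) else 0)"
  by (cases s) (auto simp: axis_def)

lemma edge_vector_nth_eq_0: "\<not> incident e v \<Longrightarrow> edge_vector e $ v = 0"
  by (cases e) (auto simp: edge_vector_nth)

text \<open>Weights are total functions on all triples, so that representations with different
  supports can be compared as functions; the graph of a representation is its support
  \<open>{e. c e \<noteq> 0}\<close>. Triples that are not edges get weight 0 through
  \<open>admissible\<close>.\<close>

definition represents :: "('n::{finite,linorder} sedge \<Rightarrow> real) \<Rightarrow> real^'n::_ \<Rightarrow> bool" where
  "represents c x \<longleftrightarrow> (\<forall>e. 0 \<le> c e) \<and> admissible {e. c e \<noteq> 0} \<and>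
     x = (\<Sum>e\<in>UNIV. c e *\<^sub>R edge_vector e)"

lemma represents_nth: "represents c x \<Longrightarrow> x $ v = (\<Sum>e\<in>UNIV. c e * edge_vector e $ v)"
  unfolding represents_def by simp

lemma incidence_nth_pos:
  assumes "admissible E" "e \<in> E" "incident e v" "incidence_sign e v = Positive"
  shows "0 < edge_vector e $ v"
proof -
  obtain i j s where e: "e = (i, j, s)" by (cases e)
  show ?thesis using assms admissible_edge[of E i j s] unfolding e edge_vector_nth
    by (auto split: if_splits)
qed

lemma incidence_nth_neg:
  assumes "admissible E" "e \<in> E" "incident e v" "incidence_sign e v = Negative"
  shows "edge_vector e $ v < 0"
proof -
  obtain i j s where e: "e = (i, j, s)" by (cases e)
  show ?thesis using assms admissible_edge[of E i j s] unfolding e edge_vector_nth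
    by (auto split: if_splits)
qed

text \<open>Alternation gives all support edges at \<open>v\<close> the same sign there, so their
  contributions to coordinate \<open>v\<close> cannot cancel. Hence any single support edge at
  \<open>v\<close> dictates the sign of \<open>x $ v\<close>, and conversely the sign pattern of
  \<open>x\<close> restricts the possible supports.\<close>

lemma represents_sign_aux:
  assumes "represents c x" "c e \<noteq> 0" "incident e v"
  shows "incidence_sign e v = Positive \<Longrightarrow> 0 < x $ v"
    and "incidence_sign e v = Negative \<Longrightarrow> x $ v < 0"
    and "c f \<noteq> 0 \<Longrightarrow> incidence_sign e v = Positive \<Longrightarrow> 0 \<le> edge_vector f $ v"
    and "c f \<noteq> 0 \<Longrightarrow> incidence_sign e v = Negative \<Longrightarrow> edge_vector f $ v \<le> 0"
proof -
  have nn: "\<And>e. 0 \<le> c e" and ad: "admissible {e. c e \<noteq> 0}"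
    using assms unfolding represents_def by auto
  note alt = admissible_alternating[OF ad, of e _ v]
  { assume s: "incidence_sign e v = Positive"
    show A: "c f \<noteq> 0 \<Longrightarrow> 0 \<le> edge_vector f $ v" for f
    proof (cases "incident f v")
      case True
      assume "c f \<noteq> 0"
      then show ?thesis using incidence_nth_pos[OF ad, of f v] alt[of f] s assms True by auto
    qed (simp add: edge_vector_nth_eq_0)
    have "0 \<le> c f * edge_vector f $ v" for f
      using A[of f] nn[of f] by (cases "c f = 0") auto
    moreover have "0 < c e * edge_vector e $ v"
      using incidence_nth_pos[OF ad, of e v] s assms nn[of e] by auto
    ultimately have "0 < (\<Sum>e\<in>UNIV. c e * edge_vector e $ v)"
      by (intro sum_pos2[of _ e]) auto
    then show "0 < x $ v" using represents_nth[OF assms(1)] by simp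
  }
  { assume s: "incidence_sign e v = Negative"
    show A: "c f \<noteq> 0 \<Longrightarrow> edge_vector f $ v \<le> 0" for f
    proof (cases "incident f v")
      case True
      assume "c f \<noteq> 0"
      then show ?thesis using incidence_nth_neg[OF ad, of f v] alt[of f] s assms True by auto
    qed (simp add: edge_vector_nth_eq_0)
    have "0 \<le> - (c f * edge_vector f $ v)" for f
      using A[of f] nn[of f] by (cases "c f = 0") (auto simp: mult_nonneg_nonpos)
    moreover have "0 < - (c e * edge_vector e $ v)"
      using incidence_nth_neg[OF ad, of e v] s assms nn[of e] by (auto simp: mult_pos_neg)
    ultimately have "0 < (\<Sum>e\<in>UNIV. - (c e * edge_vector e $ v))"
      by (intro sum_pos2[of _ e]) auto
    then show "x $ v < 0" using represents_nth[OF assms(1)] by (simp add: sum_negf)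
  }
qed

lemma represents_endpoints:
  assumes "represents c x" "c (i, j, s) \<noteq> 0"
  shows "i \<le> j" "i = j \<Longrightarrow> s = Positive" "0 < x $ i"
    "s = Positive \<Longrightarrow> 0 < x $ j" "s = Negative \<Longrightarrow> x $ j < 0" "s = Negative \<Longrightarrow> i < j"
proof -
  have ad: "admissible {e. c e \<noteq> 0}" using assms unfolding represents_def by auto
  show 1: "i \<le> j" "i = j \<Longrightarrow> s = Positive"
      using admissible_edge[OF ad, of i j s] assms by auto
  then show "s = Negative \<Longrightarrow> i < j" by (auto simp: order_le_less)
  show "0 < x $ i" using represents_sign_aux(1)[OF assms, of i] 1 by (cases "i = j") auto
  show "s = Positive \<Longrightarrow> 0 < x $ j" "s = Negative \<Longrightarrow> x $ j < 0"
    using represents_sign_aux(1,2)[OF assms, of j] by auto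
qed

lemma represents_abs_nth:
  assumes "represents c x"
  shows "\<bar>x $ v\<bar> = (\<Sum>e\<in>UNIV. c e * \<bar>edge_vector e $ v\<bar>)"
proof -
  have nn: "\<And>e. 0 \<le> c e" using assms unfolding represents_def by auto
  consider "\<forall>e. c e \<noteq> 0 \<longrightarrow> 0 \<le> edge_vector e $ v" | "\<forall>e. c e \<noteq> 0 \<longrightarrow> edge_vector e $ v \<le> 0"
  proof (cases "\<exists>e. c e \<noteq> 0 \<and> incident e v")
    case True
    then obtain e where "c e \<noteq> 0" "incident e v" by blast
    then show ?thesis using that represents_sign_aux(3,4)[OF assms]
      by (cases "incidence_sign e v") blast+
  next
    case False
    then have "\<forall>e. c e \<noteq> 0 \<longrightarrow> 0 \<le> edge_vector e $ v"
      by (metis edge_vector_nth_eq_0 order_refl)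
    then show ?thesis using that by blast
  qed
  then show ?thesis
  proof cases
    case 1
    then have "c e * \<bar>edge_vector e $ v\<bar> = c e * edge_vector e $ v" for e
      by (metis abs_of_nonneg mult_zero_left)
    then have "(\<Sum>e\<in>UNIV. c e * \<bar>edge_vector e $ v\<bar>) = x $ v"
      unfolding represents_nth[OF assms] by (rule sum.cong[OF refl])
    moreover have "0 \<le> (\<Sum>e\<in>UNIV. c e * \<bar>edge_vector e $ v\<bar>)"
      by (intro sum_nonneg mult_nonneg_nonneg nn) auto
    ultimately show ?thesis by simp
  next
    case 2
    then have "c e * \<bar>edge_vector e $ v\<bar> = - (c e * edge_vector e $ v)" for e
      by (metis abs_of_nonpos mult_zero_left mult_minus_right minus_zero)
    then have "(\<Sum>e\<in>UNIV. c e * \<bar>edge_vector e $ v\<bar>) = - x $ v"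
      unfolding represents_nth[OF assms] sum_negf[symmetric] by (rule sum.cong[OF refl])
    moreover have "0 \<le> (\<Sum>e\<in>UNIV. c e * \<bar>edge_vector e $ v\<bar>)"
      by (intro sum_nonneg mult_nonneg_nonneg nn) auto
    ultimately show ?thesis by simp
  qed
qed

text \<open>The assumption excludes \<open>(i, i, Negative)\<close>, whose vector is 0.\<close>

lemma edge_vector_l1:
  fixes i j :: "'n::finite"
  assumes "i = j \<Longrightarrow> s = Positive"
  shows "(\<Sum>v\<in>UNIV. \<bar>edge_vector (i, j, s) $ v\<bar>) = 2"
proof -
  have "\<bar>edge_vector (i, j, s) $ v\<bar> = (if v = i then 1 else 0) + (if v = j then 1 else 0)"
      for v :: 'n
    using assms by (auto simp: edge_vector_nth)
  then show ?thesis by (simp add: sum.distrib)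
qed

lemma represents_l1:
  assumes "represents c x"
  shows "(\<Sum>v\<in>UNIV. \<bar>x $ v\<bar>) = 2 * (\<Sum>e\<in>UNIV. c e)"
proof -
  have "c e * (\<Sum>v\<in>UNIV. \<bar>edge_vector e $ v\<bar>) = 2 * c e" for e
  proof (cases "c e = 0")
    case False
    obtain i j s where e: "e = (i, j, s)" by (cases e)
    have "i = j \<Longrightarrow> s = Positive"
      using represents_endpoints(2)[OF assms] False unfolding e by blast
    then show ?thesis unfolding e using edge_vector_l1[of i j s] by simp
  qed simp
  moreover have "(\<Sum>v\<in>UNIV. \<bar>x $ v\<bar>) = (\<Sum>e\<in>UNIV. c e * (\<Sum>v\<in>UNIV. \<bar>edge_vector e $ v\<bar>))"
    unfolding represents_abs_nth[OF assms] sum_distrib_left by (rule sum.swap)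
  ultimately show ?thesis by (simp add: sum_distrib_left)
qed

text \<open>The source of every forcing argument: a weight on \<open>e\<close> that does not account
  for coordinate \<open>v\<close> leaves a remainder that some other support edge at
  \<open>v\<close> has to supply.\<close>

lemma represents_other_edge:
  assumes "represents c x" "\<bar>c e * edge_vector e $ v\<bar> < \<bar>x $ v\<bar>"
  obtains f where "f \<noteq> e" "c f \<noteq> 0" "incident f v"
proof -
  have "\<exists>f. f \<noteq> e \<and> c f \<noteq> 0 \<and> incident f v"
  proof (rule ccontr)
    assume "\<not> ?thesis"
    then have z: "c f * edge_vector f $ v = 0" if "f \<noteq> e" for f
      using that edge_vector_nth_eq_0 by (metis mult_eq_0_iff)
    have "x $ v = (\<Sum>f\<in>{e}. c f * edge_vector f $ v)"
      unfolding represents_nth[OF assms(1)] by (rule sum.mono_neutral_right) (use z in auto)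
    then show False using assms by simp
  qed
  then show thesis using that by blast
qed

lemma edge_vector_sum_upd:
  "(\<Sum>f\<in>UNIV. (c(e := c e + t)) f *\<^sub>R edge_vector f) =
   (\<Sum>f\<in>UNIV. c f *\<^sub>R edge_vector f) + t *\<^sub>R (edge_vector e :: real^'n::finite)"
proof -
  have "(c(e := c e + t)) f *\<^sub>R edge_vector f =
      c f *\<^sub>R edge_vector f + (if f = e then t *\<^sub>R edge_vector e else 0)" for f
    by (auto simp: scaleR_add_left)
  then show ?thesis by (simp add: sum.distrib)
qed

text \<open>The case \<open>t = c e\<close> is allowed; then \<open>e\<close> leaves the support,
  and admissibility survives because it is hereditary.\<close>

lemma represents_diff:
  assumes "represents c x" "t \<le> c e" "0 < t"
  shows "represents (c(e := c e - t)) (x - t *\<^sub>R edge_vector e)"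
proof -
  have "{f. (c(e := c e - t)) f \<noteq> 0} \<subseteq> {f. c f \<noteq> 0}"
    using assms by (auto split: if_splits)
  then show ?thesis using assms edge_vector_sum_upd[of c e "-t"]
    unfolding represents_def by (auto intro: admissible_subset)
qed

section \<open>Greedy representation of vectors with nonnegative prefix sums\<close>

lemma edge_sign_cases: "s = Positive \<or> s = Negative"
  by (cases s) auto

text \<open>Prefix sums pair \<open>x\<close> with e_1 + ... + e_k, up to scaling the basis dual to
  the simple roots e_i - e_(i+1) and 2 e_n. So this is the cone over the positive roots, described
  by its facets.\<close>

definition dominant :: "real^'n::{finite,linorder} \<Rightarrow> bool" where
  "dominant x \<longleftrightarrow> (\<forall>k. 0 \<le> (\<Sum>i\<in>{..k}. x $ i))"

definition nonzeros :: "real^'n::finite \<Rightarrow> 'n set" where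
  "nonzeros x = {v. x $ v \<noteq> 0}"

lemma dominant_add: "dominant x \<Longrightarrow> dominant y \<Longrightarrow> dominant (x + y)"
  unfolding dominant_def by (simp add: sum.distrib)

lemma dominant_scale: "dominant x \<Longrightarrow> 0 \<le> a \<Longrightarrow> dominant (a *\<^sub>R x)"
  unfolding dominant_def by (simp flip: sum_distrib_left)

lemma dominant_sum: "(\<And>e. e \<in> A \<Longrightarrow> dominant (f e)) \<Longrightarrow> dominant (sum f A)"
  by (induction A rule: infinite_finite_induct) (auto simp: dominant_add, auto simp: dominant_def)

lemma dominant_edge_vector: "i \<le> j \<Longrightarrow> dominant (edge_vector (i, j, s))"
  unfolding dominant_def edge_vector_nth by (auto simp: sum.distrib)

lemma represents_dominant:
  assumes "represents c x"
  shows "dominant x"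
proof -
  have "dominant (c e *\<^sub>R edge_vector e)" for e
  proof (cases "c e = 0")
    case False
    obtain i j s where e: "e = (i, j, s)" by (cases e)
    show ?thesis using represents_endpoints(1)[OF assms, of i j s] False assms unfolding e
      by (intro dominant_scale dominant_edge_vector) (auto simp: represents_def)
  qed (simp add: dominant_def)
  then show ?thesis using assms unfolding represents_def by (metis dominant_sum)
qed

text \<open>Read the coordinates as supplies and demands. Negative edges must match parentheses, and once
  only supplies remain, positive edges fold them from the outside onto the loop. So some edge is forced
  to carry an explicit weight in every representation, and removing it kills a coordinate.\<close>

definition greedy :: "'n::{finite,linorder} sedge \<Rightarrow> real \<Rightarrow> real^'n::_ \<Rightarrow> bool" where
  "greedy e t x \<longleftrightarrow> 0 < t \<and> nonzeros (x - t *\<^sub>R edge_vector e) \<subset> nonzeros x \<and>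
     dominant (x - t *\<^sub>R edge_vector e) \<and>
     (\<forall>c. represents c x \<longrightarrow> t \<le> c e) \<and>
     (\<forall>c. represents c (x - t *\<^sub>R edge_vector e) \<longrightarrow> admissible (insert e {f. c f \<noteq> 0}))"

lemma greedy_represents:
  assumes "greedy e t x" "represents c (x - t *\<^sub>R edge_vector e)"
  shows "represents (c(e := c e + t)) x"
proof -
  have "{f. (c(e := c e + t)) f \<noteq> 0} \<subseteq> insert e {f. c f \<noteq> 0}"
    by auto
  moreover have "(\<Sum>f\<in>UNIV. (c(e := c e + t)) f *\<^sub>R edge_vector f) = x"
    using assms(2) unfolding edge_vector_sum_upd represents_def by (metis diff_add_cancel)
  moreover have "admissible (insert e {f. c f \<noteq> 0})" "0 < t" "\<And>f. 0 \<le> c f"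
    using assms unfolding greedy_def represents_def by blast+
  ultimately show ?thesis
    unfolding represents_def
        by (auto intro: admissible_subset add_nonneg_nonneg simp del: split_paired_All)
qed

lemma represents_other_edge_nonloop:
  assumes rep: "represents c x" and ij: "i \<noteq> j" "v = i \<or> v = j"
      and lt: "c (i, j, s) < \<bar>x $ v\<bar>"
  obtains p q r where "(p, q, r) \<noteq> (i, j, s)" "c (p, q, r) \<noteq> 0" "v = p \<or> v = q"
proof -
  have "0 \<le> c (i, j, s)" using rep unfolding represents_def by blast
  then have "\<bar>c (i, j, s) * edge_vector (i, j, s) $ v\<bar> < \<bar>x $ v\<bar>"
    using ij lt by (auto simp: edge_vector_nth)
  from represents_other_edge[OF rep this] obtain f
      where "f \<noteq> (i, j, s)" "c f \<noteq> 0" "incident f v"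
    by blast
  then show thesis using that by (cases f) auto
qed

text \<open>Match the first demand \<open>j\<close> with the nearest supply \<open>i\<close> before
  it, like an innermost pair of parentheses. All coordinates between them vanish. An edge competing
  at \<open>j\<close> therefore starts before \<open>i\<close>, and whatever competes at
  \<open>i\<close> then crosses it or is enclosed by it in a forbidden way.\<close>

lemma greedy_Negative:
  fixes x :: "real^'n::{finite,linorder}"
  assumes dom: "dominant x" and neg: "x $ v < 0"
  shows "\<exists>e t. greedy e t x"
proof -
  define j where "j = Min {j. x $ j < 0}"
  have j: "x $ j < 0" and j_min: "\<And>k. k < j \<Longrightarrow> 0 \<le> x $ k"
    using neg Min_in[of "{j. x $ j < 0}"] Min_le[of "{j. x $ j < 0}"]
    unfolding j_def by (auto simp: not_le[symmetric])
  \<comment> \<open>Otherwise the prefix sum ending at \<open>j\<close> would equal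
    \<open>x $ j < 0\<close>.\<close>
  have "{i. i < j \<and> 0 < x $ i} \<noteq> {}"
  proof
    assume "{i. i < j \<and> 0 < x $ i} = {}"
    then have "(\<Sum>i\<in>{..<j}. x $ i) = 0" using j_min by (intro sum.neutral) force
    moreover have "{..j} = insert j {..<j}" by auto
    ultimately show False using dom j unfolding dominant_def by (auto dest!: spec[of _ j])
  qed
  define i where "i = Max {i. i < j \<and> 0 < x $ i}"
  have i: "i < j" "0 < x $ i"
      and i_max: "\<And>k. k < j \<Longrightarrow> 0 < x $ k \<Longrightarrow> k \<le> i"
    using Max_in[of "{i. i < j \<and> 0 < x $ i}"] Max_ge[of "{i. i < j \<and> 0 < x $ i}"]
      \<open>{i. i < j \<and> 0 < x $ i} \<noteq> {}\<close> unfolding i_def by auto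
  have ij: "i \<noteq> j" using i by simp
  have mid: "x $ k = 0" if "i < k" "k < j" for k
    using j_min[OF that(2)] i_max[OF that(2)] that(1) by force
  \<comment> \<open>The largest amount that both ends can bear; at least one of the two coordinates
    then vanishes.\<close>
  define t where "t = min (x $ i) (- x $ j)"
  define y where "y = x - t *\<^sub>R edge_vector (i, j, Negative)"
  have t: "0 < t" "t \<le> x $ i" "t \<le> - x $ j" "t = x $ i \<or> t = - x $ j"
    using i j unfolding t_def by auto
  have y: "y $ v = (if v = i then x $ i - t else if v = j then x $ j + t else x $ v)" for v
    unfolding y_def using i by (auto simp: edge_vector_nth simp del: edge_vector.simps)
  have y_pos: "0 < x $ k \<and> k \<noteq> j \<and> (k \<le> i \<or> j < k)" if "0 < y $ k" for k
    using that i j t mid[of k] i_max[of k] unfolding y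
    by (cases k j rule: linorder_cases) (auto split: if_splits)
  have y_neg: "x $ k < 0 \<and> k \<noteq> i \<and> j \<le> k" if "y $ k < 0" for k
    using that i j t mid[of k] j_min[of k] unfolding y
        by (cases k j rule: linorder_cases) (auto split: if_splits)
  have "nonzeros y \<subset> nonzeros x"
  proof
    show "nonzeros y \<subseteq> nonzeros x"
    proof
      fix k assume "k \<in> nonzeros y"
      then have "y $ k < 0 \<or> 0 < y $ k" by (auto simp: nonzeros_def)
      then show "k \<in> nonzeros x" using y_pos[of k] y_neg[of k] by (auto simp: nonzeros_def)
    qed
    have "i \<notin> nonzeros y \<or> j \<notin> nonzeros y" "i \<in> nonzeros x" "j \<in> nonzeros x"
      using t(4) i j by (auto simp: y nonzeros_def)
    then show "nonzeros y \<noteq> nonzeros x" by blast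
  qed
  moreover have "dominant y"
    unfolding dominant_def
  proof
    fix k
    have eq: "(\<Sum>v\<in>{..k}. y $ v) = (\<Sum>v\<in>{..k}. x $ v) - (if i \<le> k \<and> k < j then t else 0)"
    proof -
      have "y $ v = x $ v - (if v = i then t else 0) + (if v = j then t else 0)" for v
        using y i by auto
      then show ?thesis using i by (auto simp: sum.distrib sum_subtractf)
    qed
    \<comment> \<open>Only prefixes ending at \<open>i\<close> or between \<open>i\<close> and
      \<open>j\<close> change. Such a prefix sum of \<open>x\<close> equals the one ending at
      \<open>i\<close>, which is at least \<open>x $ i\<close> because no demand precedes
      \<open>j\<close>.\<close>
    show "0 \<le> (\<Sum>v\<in>{..k}. y $ v)"
    proof (cases "i \<le> k \<and> k < j")
      case True
      have "(\<Sum>v\<in>{..k}. x $ v) = (\<Sum>v\<in>{..i}. x $ v)"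
      proof (rule sum.mono_neutral_right)
        show "\<forall>v\<in>{..k} - {..i}. x $ v = 0"
          using True mid by (meson Diff_iff atMost_iff not_le order_le_less_trans)
      qed (use True in auto)
      also have "\<dots> = x $ i + (\<Sum>v\<in>{..<i}. x $ v)"
      proof -
        have "{..i} = insert i {..<i}" by auto
        then show ?thesis by simp
      qed
      also have "\<dots> \<ge> t"
      proof -
        have "0 \<le> (\<Sum>v\<in>{..<i}. x $ v)" using j_min i by (intro sum_nonneg) force
        then show ?thesis using t by simp
      qed
      finally show ?thesis unfolding eq using True by simp
    next
      case False
      then show ?thesis unfolding eq using dom by (auto simp: dominant_def)
    qed
  qed
  moreover have "t \<le> c (i, j, Negative)" if rep: "represents c x" for c
  proof (rule ccontr)
    assume "\<not> t \<le> c (i, j, Negative)"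
    then have lt': "c (i, j, Negative) < \<bar>x $ i\<bar>" "c (i, j, Negative) < \<bar>x $ j\<bar>"
        and ne: "i \<noteq> j"
      using t ij by auto
    have ad: "admissible {e. c e \<noteq> 0}" and nn: "\<And>e. 0 \<le> c e"
      using rep unfolding represents_def by auto
    obtain p q s
        where f: "(p, q, s) \<noteq> (i, j, Negative)" "c (p, q, s) \<noteq> 0" "j = p \<or> j = q"
      by (rule represents_other_edge_nonloop[OF rep ne _ lt'(2)]) blast+
    note fe = represents_endpoints[OF rep f(2)]
    have f': "q = j" "s = Negative" "p < i"
      using fe f j i_max[of p] i edge_sign_cases[of s] by (auto simp: order_le_less)
    obtain p' q' s'
        where g: "(p', q', s') \<noteq> (i, j, Negative)" "c (p', q', s') \<noteq> 0" "i = p' \<or> i = q'"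
      by (rule represents_other_edge_nonloop[OF rep ne _ lt'(1)]) blast+
    note ge = represents_endpoints[OF rep g(2)]
    have fE: "(p, j, Negative) \<in> {e. c e \<noteq> 0}"
        and gE: "(p', q', s') \<in> {e. c e \<noteq> 0}"
      using f f' g by auto
    \<comment> \<open>The competitor at \<open>j\<close> is a negative edge from
      \<open>p < i\<close>. The competitor at \<open>i\<close> is an edge going right, which must
      pass beyond \<open>j\<close> and crosses it; or a loop underneath it; or a positive edge
      ending at \<open>i\<close>, which lies underneath it or crosses it.\<close>
    consider (a) "p' = i" "i < q'" | (b) "p' = i" "q' = i" "s' = Positive" | (c) "p' < i" "q' = i" "s' = Positive"
      using ge g i edge_sign_cases[of s'] by (auto simp: order_le_less)
    then show False
    proof cases
      case a
      have "x $ q' \<noteq> 0" using ge edge_sign_cases[of s'] by fastforce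
      moreover have "q' \<noteq> j" using a g ge j edge_sign_cases[of s'] by force
      ultimately have "j < q'" using mid[of q'] a by (meson linorder_neqE)
      then show False using admissible_noncrossing[OF ad fE gE] a f' i by auto
    next
      case b
      then show False using admissible_loop_Negative[OF ad _ fE, of i] gE f' i by auto
    next
      case c
      show False
      proof (cases "p \<le> p'")
        case True
        then show False using admissible_Positive_Negative[OF ad _ fE, of p' i] gE c i by auto
      next
        case False
        then show False using admissible_noncrossing[OF ad gE fE] c f' i by (auto simp: not_le)
      qed
    qed
  qed
  moreover have "admissible (insert (i, j, Negative) {f. c f \<noteq> 0})" if rep: "represents c y"
      for c
  proof -
    let ?S = "{f. c f \<noteq> 0}"
    have S: "p \<le> q" "p = q \<Longrightarrow> s = Positive" "p \<le> i \<or> j < p" "0 < x $ p"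
      "s = Positive \<Longrightarrow> q \<noteq> j \<and> (q \<le> i \<or> j < q) \<and> 0 < x $ q"
      "s = Negative \<Longrightarrow> q \<noteq> i \<and> j \<le> q \<and> x $ q < 0"
          if "c (p, q, s) \<noteq> 0" for p q s
      using represents_endpoints[OF rep that] y_pos[of p] y_pos[of q] y_neg[of q] by auto
    have ad: "admissible ?S" using rep unfolding represents_def by auto
    \<comment> \<open>No endpoint of the remaining support lies strictly between \<open>i\<close>
      and \<open>j\<close>, so the new edge crosses nothing and covers no loop and no positive
      edge.\<close>
    have out: "\<not> (i < p \<and> p < j)" "\<not> (i < q \<and> q < j)"
        if "c (p, q, s) \<noteq> 0" for p q s
      using S[OF that] edge_sign_cases[of s] by (auto simp: not_less not_le)
    have sg: "incidence_sign (p, q, s) v = Positive"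
        if "c (p, q, s) \<noteq> 0" "v = p \<or> v = q" "v = i" for p q s v
      using S[OF that(1)] that i by auto
    have sg': "incidence_sign (p, q, s) v = Negative"
        if "c (p, q, s) \<noteq> 0" "v = p \<or> v = q" "v = j" for p q s v
      using S[OF that(1)] that j edge_sign_cases[of s] by auto
    show ?thesis
      unfolding admissible_def
    proof (intro conjI allI impI ballI, goal_cases)
      case 1 then show ?case using S(1) i by auto
    next
      case 2 then show ?case using S(2) i by auto
    next
      case (3 v e f)
      have *: "(v = i \<longrightarrow> incidence_sign g v = Positive) \<and> (v = j \<longrightarrow> incidence_sign g v = Negative)"
        if "g \<in> insert (i, j, Negative) ?S" "incident g v" for g
      proof (cases "g = (i, j, Negative)")
        case True
        then show ?thesis using i by auto
      next
        case False
        obtain p q s where g: "g = (p, q, s)" by (cases g)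
        have "c (p, q, s) \<noteq> 0" "v = p \<or> v = q" using that False g by auto
        then show ?thesis using sg[of p q s v] sg'[of p q s v] unfolding g by blast
      qed
      show ?case
      proof (cases "v = i \<or> v = j")
        case True
        then show ?thesis using *[OF 3(1)] *[OF 3(2)] 3(3) by metis
      next
        case False
        then have "e \<in> ?S" "f \<in> ?S" using 3 by auto
        then show ?thesis using admissible_alternating[OF ad] 3(3) by blast
      qed
    next
      case (4 a b c d s t)
      then show ?case
        using admissible_noncrossing[OF ad, of a c s b d t] out[of a c s] out[of b d t] i
        by (auto simp: not_le)
    next
      case 5 then show ?case using admissible_Positive(1)[OF ad] by auto
    next
      case 6 then show ?case using admissible_Positive(2)[OF ad] by auto
    next
      case 7 then show ?case using admissible_loop_Positive(1)[OF ad] by auto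
    next
      case 8 then show ?case using admissible_loop_Positive(2)[OF ad] by auto
    next
      case (9 a k l)
      then show ?case using admissible_loop_Negative[OF ad, of a k l] out[of a a] i
        by (auto simp: not_le)
    next
      case (10 a b k l)
      show ?case
      proof
        assume "k \<le> a \<and> a < b \<and> b \<le> l"
        then show False
          using 10 admissible_Positive_Negative[OF ad, of a b k l] S(5)[of a b Positive] by auto
      qed
    next
      case 11 then show ?case using admissible_loop_unique[OF ad] by auto
    qed
  qed
  ultimately show ?thesis using t(1) unfolding greedy_def y_def by blast
qed

lemma represents_0: "represents c 0 \<Longrightarrow> c e = 0"
  using represents_endpoints(3)[of c 0] by (cases e) auto

lemma admissible_singleton:
  "i \<le> j \<Longrightarrow> (i = j \<Longrightarrow> s = Positive) \<Longrightarrow> admissible {(i, j, s)}"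
  unfolding admissible_def by auto

text \<open>The innermost stage of the folding, with a single supply left. The weight is halved
  because a loop contributes 2 to its coordinate.\<close>

lemma greedy_loop:
  fixes x :: "real^'n::{finite,linorder}"
  assumes i: "0 < x $ i" and nz: "nonzeros x = {i}"
  shows "greedy (i, i, Positive) (x $ i / 2) x"
proof -
  have 0: "x - (x $ i / 2) *\<^sub>R edge_vector (i, i, Positive) = 0"
    using nz by (auto simp: vec_eq_iff edge_vector_nth nonzeros_def simp del: edge_vector.simps)
  have "x $ i / 2 \<le> c (i, i, Positive)" if rep: "represents c x" for c
  proof (rule ccontr)
    assume "\<not> ?thesis"
    moreover have "0 \<le> c (i, i, Positive)" using rep unfolding represents_def by auto
    ultimately have "\<bar>c (i, i, Positive) * edge_vector (i, i, Positive) $ i\<bar> < \<bar>x $ i\<bar>"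
      using i by (simp add: edge_vector_nth del: edge_vector.simps)
    from represents_other_edge[OF rep this]
    obtain p q s where f: "(p, q, s) \<noteq> (i, i, Positive)" "c (p, q, s) \<noteq> 0"
      by (metis prod_cases3)
    note fe = represents_endpoints[OF rep f(2)]
    have "p \<in> nonzeros x" "q \<in> nonzeros x" using fe edge_sign_cases[of s]
        unfolding nonzeros_def by auto
    then show False using f(1) fe(2) nz by auto
  qed
  then show ?thesis unfolding greedy_def 0 using i nz
    by (auto simp: represents_0 admissible_singleton nonzeros_def dominant_def)
qed

text \<open>Without demands every support edge is positive. Positive nonloop edges must overlap
  pairwise without crossing, hence they nest around the loop, and the outermost one joins the first
  and the last supply.\<close>

lemma greedy_Positive:
  fixes x :: "real^'n::{finite,linorder}"
  assumes nonneg: "\<And>v. 0 \<le> x $ v" and pos: "0 < x $ u" "0 < x $ w" "u \<noteq> w"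
  shows "\<exists>e t. greedy e t x"
proof -
  define i where "i = Min (nonzeros x)"
  define j where "j = Max (nonzeros x)"
  have u: "u \<in> nonzeros x" "w \<in> nonzeros x" using pos unfolding nonzeros_def by auto
  have ends: "i \<in> nonzeros x" "j \<in> nonzeros x" "\<And>v. v \<in> nonzeros x \<Longrightarrow> i \<le> v \<and> v \<le> j"
    using u unfolding i_def j_def by (auto intro: Min_in Max_in)
  have ij: "i < j" using ends(3)[OF u(1)] ends(3)[OF u(2)] pos(3) by auto
  have xi: "0 < x $ i" "0 < x $ j"
    using ends nonneg[of i] nonneg[of j] unfolding nonzeros_def by auto
  define t where "t = min (x $ i) (x $ j)"
  define y where "y = x - t *\<^sub>R edge_vector (i, j, Positive)"
  have t: "0 < t" "t \<le> x $ i" "t \<le> x $ j" "t = x $ i \<or> t = x $ j"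
    using xi unfolding t_def by auto
  have y: "y $ v = (if v = i then x $ i - t else if v = j then x $ j - t else x $ v)" for v
    unfolding y_def using ij by (auto simp: edge_vector_nth simp del: edge_vector.simps)
  have y_nonneg: "0 \<le> y $ v" for v using t nonneg unfolding y by auto
  have sub: "nonzeros y \<subseteq> nonzeros x" using xi unfolding nonzeros_def y by auto
  moreover have "nonzeros y \<noteq> nonzeros x"
  proof -
    have "i \<notin> nonzeros y \<or> j \<notin> nonzeros y" using t(4) ij
        by (auto simp: y nonzeros_def)
    then show ?thesis using ends by blast
  qed
  moreover have "dominant y" using y_nonneg unfolding dominant_def by (auto intro: sum_nonneg)
  moreover have "t \<le> c (i, j, Positive)" if rep: "represents c x" for c
  proof (rule ccontr)
    assume "\<not> t \<le> c (i, j, Positive)"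
    then have lt': "c (i, j, Positive) < \<bar>x $ i\<bar>" "c (i, j, Positive) < \<bar>x $ j\<bar>"
        and ne: "i \<noteq> j"
      using t ij by auto
    have ad: "admissible {e. c e \<noteq> 0}" and nn: "\<And>e. 0 \<le> c e"
      using rep unfolding represents_def by auto
    have P: "s = Positive \<and> p \<le> q \<and> i \<le> p \<and> q \<le> j"
        if "c (p, q, s) \<noteq> 0" for p q s
      using represents_endpoints[OF rep that] nonneg[of q] ends(3)[of p] ends(3)[of q]
        edge_sign_cases[of s] unfolding nonzeros_def by force
    obtain p q s
        where f0: "(p, q, s) \<noteq> (i, j, Positive)" "c (p, q, s) \<noteq> 0" "i = p \<or> i = q"
      by (rule represents_other_edge_nonloop[OF rep ne _ lt'(1)]) blast+
    have f: "(i, q, Positive) \<in> {e. c e \<noteq> 0}" "i \<le> q" "q < j"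
      using f0 P[OF f0(2)] by (auto simp: order_le_less)
    obtain p' q' s'
        where g0: "(p', q', s') \<noteq> (i, j, Positive)" "c (p', q', s') \<noteq> 0" "j = p' \<or> j = q'"
      by (rule represents_other_edge_nonloop[OF rep ne _ lt'(2)]) blast+
    have g: "(p', j, Positive) \<in> {e. c e \<noteq> 0}" "i < p'" "p' \<le> j"
      using g0 P[OF g0(2)] by (auto simp: order_le_less)
    \<comment> \<open>One competitor leaves \<open>i\<close> and stops before \<open>j\<close>, the
      other ends at \<open>j\<close> and starts after \<open>i\<close>. If one of them is a loop,
      the other is a second loop or fails to enclose it; if neither is, the two must overlap and
      then they cross.\<close>
    show False
    proof (cases "i = q"; cases "p' = j")
      assume "i = q" "p' = j"
      then show False using admissible_loop_unique[OF ad, of i j] f g by auto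
    next
      assume "i = q" "p' \<noteq> j"
      then show False using admissible_loop_Positive(1)[OF ad, of i p' j] f g
          by (auto simp: order_le_less)
    next
      assume "i \<noteq> q" "p' = j"
      then show False using admissible_loop_Positive(2)[OF ad, of j i q] f g
          by (auto simp: order_le_less)
    next
      assume "i \<noteq> q" "p' \<noteq> j"
      then have "p' < q" using admissible_Positive(2)[OF ad f(1) g(1)] f g by (auto simp: order_le_less)
      then show False using admissible_noncrossing[OF ad f(1) g(1)] f g by auto
    qed
  qed
  moreover have "admissible (insert (i, j, Positive) {f. c f \<noteq> 0})" if rep: "represents c y"
      for c
  proof -
    let ?S = "{f. c f \<noteq> 0}"
    have ad: "admissible ?S" using rep unfolding represents_def by auto
    have P: "s = Positive" "p \<le> q" "i \<le> p" "q \<le> j" if "c (p, q, s) \<noteq> 0" for p q s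
    proof -
      show "s = Positive" "p \<le> q"
        using represents_endpoints[OF rep that] y_nonneg[of q] edge_sign_cases[of s] by force+
      then have "p \<in> nonzeros y" "q \<in> nonzeros y"
        using represents_endpoints[OF rep that] unfolding nonzeros_def by auto
      then show "i \<le> p" "q \<le> j" using sub ends(3) by blast+
    qed
    have P': "i < q" "p < j" if "c (p, q, s) \<noteq> 0" "p < q" for p q s
      using P[OF that(1)] that(2) by auto
    have sg: "incidence_sign (p, q, s) v = Positive" if "c (p, q, s) \<noteq> 0" for p q s v
      using P[OF that] by auto
    show ?thesis
      unfolding admissible_def
    proof (intro conjI allI impI ballI, goal_cases)
      case 1 then show ?case using P ij by auto
    next
      case 2 then show ?case using P ij by auto
    next
      case (3 v e f)
      have *: "incidence_sign g v = Positive" if "g \<in> insert (i, j, Positive) ?S" for g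
      proof -
        obtain p q s where g: "g = (p, q, s)" by (cases g)
        show ?thesis using that sg[of p q s v] unfolding g by auto
      qed
      show ?case using *[OF 3(1)] *[OF 3(2)] by simp
    next
      case (4 a b c d s t)
      then show ?case
        using admissible_noncrossing[OF ad, of a c s b d t] P[of a c s] P[of b d t] ij
        by (auto simp: not_le)
    next
      case (5 a b c d)
      then show ?case
        using admissible_Positive(1)[OF ad, of a b c d] P'[of a b Positive] P'[of c d Positive] ij
        by auto
    next
      case (6 a b c d)
      then show ?case
        using admissible_Positive(2)[OF ad, of a b c d] P'[of a b Positive] P'[of c d Positive] ij
        by auto
    next
      case (7 a c d)
      then show ?case
        using admissible_loop_Positive(1)[OF ad, of a c d] P[of a a] P[of c d] ij by auto
    next
      case (8 a c d)
      then show ?case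
        using admissible_loop_Positive(2)[OF ad, of a c d] P[of a a] P[of c d] ij by auto
    next
      case 9 then show ?case using P ij by auto
    next
      case 10 then show ?case using P ij by auto
    next
      case 11 then show ?case using admissible_loop_unique[OF ad] ij by auto
    qed
  qed
  ultimately show ?thesis using t(1) unfolding greedy_def y_def by blast
qed

lemma greedy_exists:
  fixes x :: "real^'n::{finite,linorder}"
  assumes "dominant x" "x \<noteq> 0"
  shows "\<exists>e t. greedy e t x"
proof (cases "\<exists>v. x $ v < 0")
  case True
  then show ?thesis using greedy_Negative assms by blast
next
  case False
  then have nonneg: "\<And>v. 0 \<le> x $ v" by (simp add: not_less)
  obtain u where u: "x $ u \<noteq> 0" using assms(2) by (auto simp: vec_eq_iff)
  then have u': "0 < x $ u" using nonneg[of u] by simp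
  show ?thesis
  proof (cases "nonzeros x = {u}")
    case True
    then show ?thesis using greedy_loop[OF u'] by blast
  next
    case False
    then obtain w where "w \<noteq> u" "x $ w \<noteq> 0" using u unfolding nonzeros_def by auto
    then show ?thesis using greedy_Positive[OF nonneg u', of w] nonneg[of w] by (metis order_le_less)
  qed
qed

lemma dominant_imp_represents:
  fixes x :: "real^'n::{finite,linorder}"
  assumes "dominant x"
  shows "\<exists>c. represents c x"
  using assms
proof (induction "card (nonzeros x)" arbitrary: x rule: less_induct)
  case less
  show ?case
  proof (cases "x = 0")
    case True
    have "represents (\<lambda>_. 0) (0 :: real^'n::_)" unfolding represents_def admissible_def by simp
    then show ?thesis using True by blast
  next
    case False
    then obtain e t where g: "greedy e t x" using greedy_exists less.prems by blast
    then have "card (nonzeros (x - t *\<^sub>R edge_vector e)) < card (nonzeros x)"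
      unfolding greedy_def by (intro psubset_card_mono) auto
    then show ?thesis using less.hyps g greedy_represents[OF g] unfolding greedy_def by blast
  qed
qed

text \<open>Every representation puts weight at least \<open>t\<close> on the greedy edge, so the
  same amount can be removed from both; the remainders represent a vector with fewer nonzero
  coordinates.\<close>

theorem represents_unique:
  fixes x :: "real^'n::{finite,linorder}"
  assumes "represents c x" "represents d x"
  shows "c = d"
  using assms
proof (induction "card (nonzeros x)" arbitrary: x c d rule: less_induct)
  case less
  show ?case
  proof (cases "x = 0")
    case True
    then have "c f = d f" for f using less.prems represents_0[of c f] represents_0[of d f] by simp
    then show ?thesis by blast
  next
    case False
    then obtain e t where g: "greedy e t x"
      using greedy_exists less.prems represents_dominant by blast
    then have t: "t \<le> c e" "t \<le> d e" "0 < t" using less.prems unfolding greedy_def by auto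
    from g have "card (nonzeros (x - t *\<^sub>R edge_vector e)) < card (nonzeros x)"
      unfolding greedy_def by (intro psubset_card_mono) auto
    then have eq: "c(e := c e - t) = d(e := d e - t)"
      using less.hyps represents_diff[OF less.prems(1) t(1,3)] represents_diff[OF less.prems(2) t(2,3)]
      by blast
    have "c f = d f" for f using fun_cong[OF eq, of f] by (auto split: if_splits)
    then show ?thesis by blast
  qed
qed

section \<open>The simplices\<close>

text \<open>Extending weights by 0 off \<open>E\<close> lets \<open>represents_unique\<close>
  compare representations that belong to different graphs.\<close>

lemma represents_restrict:
  assumes "admissible E" "\<And>e. e \<in> E \<Longrightarrow> 0 \<le> c e"
  shows "represents (\<lambda>e. if e \<in> E then c e else 0) (\<Sum>e\<in>E. c e *\<^sub>R edge_vector e)"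
  unfolding represents_def
proof (intro conjI allI)
  show "admissible {e. (if e \<in> E then c e else 0) \<noteq> 0}"
    using assms(1) by (rule admissible_subset) auto
  show "(\<Sum>e\<in>E. c e *\<^sub>R edge_vector e) =
      (\<Sum>e\<in>UNIV. (if e \<in> E then c e else 0) *\<^sub>R edge_vector e)"
    by (rule sum.mono_neutral_cong_left) auto
  show "0 \<le> (if e \<in> E then c e else 0)" for e using assms(2) by simp
qed

text \<open>A linear relation with large constants added becomes two nonnegative representations of the
  same vector.\<close>

lemma admissible_coefficients:
  fixes E :: "'n::{finite,linorder} sedge set"
  assumes ad: "admissible E" and eq: "(\<Sum>e\<in>E. u e *\<^sub>R edge_vector e) = 0"
      and e: "e \<in> E"
  shows "u e = 0"
proof -
  define b where "b = (\<Sum>f\<in>E. \<bar>u f\<bar>)"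
  have b: "\<bar>u f\<bar> \<le> b" if "f \<in> E" for f
    unfolding b_def using that by (intro member_le_sum) auto
  have r1: "represents (\<lambda>f. if f \<in> E then b + u f else 0) (\<Sum>f\<in>E. (b + u f) *\<^sub>R edge_vector f)"
    by (intro represents_restrict ad) (use b in fastforce)
  have r2: "represents (\<lambda>f. if f \<in> E then b else 0) (\<Sum>f\<in>E. b *\<^sub>R edge_vector f)"
    by (intro represents_restrict ad) (use b in fastforce)
  have "(\<Sum>f\<in>E. (b + u f) *\<^sub>R edge_vector f) = (\<Sum>f\<in>E. b *\<^sub>R edge_vector f)"
    using eq by (simp add: scaleR_add_left sum.distrib)
  then have eq': "(\<lambda>f. if f \<in> E then b + u f else 0) = (\<lambda>f. if f \<in> E then b else 0)"
    using r1 r2 by (intro represents_unique) simp_all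
  show ?thesis using fun_cong[OF eq', of e] e by simp
qed

text \<open>Independence of the image set would still allow two edges to share a vector; counting
  edges by dimension needs this excluded as well.\<close>

lemma inj_on_edge_vector:
  fixes E :: "'n::{finite,linorder} sedge set"
  assumes "admissible E"
  shows "inj_on edge_vector E"
proof (rule inj_onI, rule ccontr)
  fix e f assume ef: "e \<in> E" "f \<in> E" "edge_vector e = edge_vector f" "e \<noteq> f"
  define u where "u = (\<lambda>g. (if g = e then 1 else 0) - (if g = f then 1 else 0) :: real)"
  have "(\<Sum>g\<in>E. u g *\<^sub>R edge_vector g) =
      (\<Sum>g\<in>E. if g = e then edge_vector g else 0) - (\<Sum>g\<in>E. if g = f then edge_vector g else 0)"
    unfolding u_def sum_subtractf[symmetric] by (intro sum.cong) auto
  also have "\<dots> = 0" using ef by simp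
  finally have "u e = 0" using admissible_coefficients assms ef(1) by blast
  then show False using ef(4) unfolding u_def by simp
qed

lemma independent_edge_vectors:
  fixes E :: "'n::{finite,linorder} sedge set"
  assumes "admissible E"
  shows "independent (edge_vector ` E)"
  unfolding independent_explicit
proof (intro conjI allI impI ballI)
  fix u v assume "(\<Sum>v\<in>edge_vector ` E. u v *\<^sub>R v) = 0" "v \<in> edge_vector ` E"
  then show "u v = 0"
    using admissible_coefficients[OF assms, of "\<lambda>e. u (edge_vector e)"]
    by (auto simp: sum.reindex[OF inj_on_edge_vector[OF assms]] o_def)
qed simp

section \<open>The simplex attached to one graph\<close>

lemma positive_roots_eq:
  "(positive_roots :: (real^'n::{finite,linorder}) set) = edge_vector ` {(i, j, s). i \<le> j \<and> (i = j \<longrightarrow> s = Positive)}"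
proof (intro equalityI subsetI)
  fix x :: "real^'n::_" assume "x \<in> positive_roots"
  then consider i j where "i < j" "x = axis i 1 - axis j 1" | i j
      where "i < j" "x = axis i 1 + axis j 1"
    | k where "x = 2 *\<^sub>R axis k 1"
    unfolding positive_roots_def by blast
  then show "x \<in> edge_vector ` {(i, j, s). i \<le> j \<and> (i = j \<longrightarrow> s = Positive)}"
  proof cases
    case (1 i j)
    then show ?thesis by (intro image_eqI[where x = "(i, j, Negative)"]) auto
  next
    case (2 i j)
    then show ?thesis by (intro image_eqI[where x = "(i, j, Positive)"]) auto
  next
    case (3 k)
    then show ?thesis by (intro image_eqI[where x = "(k, k, Positive)"]) (auto simp: scaleR_2)
  qed
next
  fix x :: "real^'n::_"
  assume "x \<in> edge_vector ` {(i, j, s). i \<le> j \<and> (i = j \<longrightarrow> s = Positive)}"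
  then obtain i j s
      where x: "x = edge_vector (i, j, s)" "i \<le> j" "i = j \<Longrightarrow> s = Positive" by auto
  then show "x \<in> positive_roots"
    using edge_sign_cases[of s] unfolding positive_roots_def
    by (cases "i = j") (auto simp: scaleR_2[symmetric] order_le_less)
qed

lemma positive_roots_Int_graph_cone:
  fixes T :: "'n::{finite,linorder} sgraph"
  assumes ad: "admissible (set_mset T)"
  shows "positive_roots \<inter> graph_cone T = edge_vector ` set_mset T"
proof (intro equalityI subsetI IntI)
  fix x assume "x \<in> positive_roots \<inter> graph_cone T"
  then obtain i j s
      where x: "x = edge_vector (i, j, s)" "i \<le> j" "i = j \<Longrightarrow> s = Positive"
    and "x \<in> graph_cone T" unfolding positive_roots_eq by auto
  then obtain c
      where c: "\<And>e. e \<in># T \<Longrightarrow> 0 \<le> c e" "x = (\<Sum>e\<in>set_mset T. c e *\<^sub>R edge_vector e)"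
    unfolding graph_cone_def by blast
  have "represents (\<lambda>e. if e \<in># T then c e else 0) x"
    unfolding c(2) by (intro represents_restrict ad c(1))
  \<comment> \<open>A root is represented by its own edge with weight 1, so uniqueness forces that
    edge into \<open>T\<close>.\<close>
  moreover have "represents (\<lambda>e. if e \<in> {(i, j, s)} then 1 else 0) (\<Sum>e\<in>{(i, j, s)}. 1 *\<^sub>R edge_vector e)"
    by (intro represents_restrict admissible_singleton x) auto
  ultimately have eq: "(\<lambda>e. if e \<in># T then c e else 0) = (\<lambda>e. if e \<in> {(i, j, s)} then 1 else 0)"
    unfolding x(1) by (intro represents_unique) simp_all
  show "x \<in> edge_vector ` set_mset T"
    using fun_cong[OF eq, of "(i, j, s)"] x(1) by (auto split: if_splits)
next
  fix x assume "x \<in> edge_vector ` set_mset T"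
  then obtain e where e: "e \<in># T" "x = edge_vector e" by blast
  obtain i j s where "e = (i, j, s)" by (cases e)
  then show "x \<in> positive_roots"
    using e admissible_edge[OF ad] unfolding positive_roots_eq by blast
  have "x = (\<Sum>f\<in>set_mset T. (if f = e then 1 else 0) *\<^sub>R edge_vector f)"
    using e by (simp add: if_distrib[of "\<lambda>a. a *\<^sub>R _"] cong: if_cong)
  then show "x \<in> graph_cone T" unfolding graph_cone_def
    by (intro CollectI exI[of _ "\<lambda>f. if f = e then 1 else 0"]) auto
qed

lemma root_polytope_eq:
  fixes T :: "'n::{finite,linorder} sgraph"
  assumes "admissible (set_mset T)"
  shows "root_polytope T = convex hull (insert 0 (edge_vector ` set_mset T))"
  unfolding root_polytope_def positive_roots_Int_graph_cone[OF assms] ..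

lemma affine_independent_edge_vectors:
  fixes E :: "'n::{finite,linorder} sedge set"
  assumes "admissible E"
  shows "\<not> affine_dependent (insert 0 (edge_vector ` E))" "0 \<notin> edge_vector ` E"
proof -
  show "0 \<notin> edge_vector ` E" using independent_edge_vectors[OF assms] dependent_zero by blast
  show "\<not> affine_dependent (insert 0 (edge_vector ` E))"
    using independent_edge_vectors[OF assms] using affine_dependent_imp_dependent2 by blast
qed

text \<open>Relative interior points have strictly positive barycentric coordinates, so no edge
  drops out of the support. By uniqueness such a point determines its graph.\<close>

lemma rel_interior_root_polytope:
  fixes T :: "'n::{finite,linorder} sgraph"
  assumes ad: "admissible (set_mset T)" and x: "x \<in> rel_interior (root_polytope T)"
  obtains c where "represents c x" "{e. c e \<noteq> 0} = set_mset T"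
proof -
  let ?V = "edge_vector ` set_mset T"
  obtain u where u: "\<And>y. y \<in> insert 0 ?V \<Longrightarrow> 0 < u y" "x = (\<Sum>y\<in>insert 0 ?V. u y *\<^sub>R y)"
    using x unfolding root_polytope_eq[OF ad]
      rel_interior_convex_hull_explicit[OF affine_independent_edge_vectors(1)[OF ad]] by blast
  have "x = (\<Sum>y\<in>?V. u y *\<^sub>R y)"
    using u(2) affine_independent_edge_vectors(2)[OF ad] by simp
  also have "\<dots> = (\<Sum>e\<in>set_mset T. u (edge_vector e) *\<^sub>R edge_vector e)"
    by (simp add: sum.reindex[OF inj_on_edge_vector[OF ad]])
  finally have "represents (\<lambda>e. if e \<in># T then u (edge_vector e) else 0) x"
    using represents_restrict[OF ad, of "\<lambda>e. u (edge_vector e)"] u(1) by (simp add: less_imp_le)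
  moreover have "u (edge_vector e) \<noteq> 0" if "e \<in># T" for e
    using u(1)[of "edge_vector e"] that by auto
  then have "{e. (if e \<in># T then u (edge_vector e) else 0) \<noteq> 0} = set_mset T" by auto
  ultimately show thesis by (rule that)
qed

lemma well_structured_admissible:
  assumes ws: "well_structured V T" and alt: "alternating T"
  shows "admissible (set_mset T)"
proof -
  note w = ws[unfolded well_structured_def]
  have sg: "signed_graph V T" and nc: "noncrossing T" and
    loops: "size {#(i, j, s) \<in># T. i = j#} = 1"
    using w by blast+
  show ?thesis
    unfolding admissible_def
  proof (intro conjI, goal_cases)
    case 1 then show ?case using sg unfolding signed_graph_def by fast
  next
    case 2 then show ?case using alt unfolding alternating_def .
  next
    case 3 then show ?case using nc unfolding noncrossing_def by blast
  next
    case 4 then show ?case using w by blast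
  next
    case 5 then show ?case using w by blast
  next
    case 6 then show ?case using w by blast
  next
    case 7 then show ?case using w by blast
  next
    case 8
    obtain l where l: "{#(i, j, s) \<in># T. i = j#} = {#l#}"
      using loops size_1_singleton_mset by metis
    have "e = l" if "e \<in># T" "fst e = fst (snd e)" for e
    proof -
      have "e \<in># {#(i, j, s) \<in># T. i = j#}" using that by (auto split: prod.splits)
      then show ?thesis unfolding l by simp
    qed
    then show ?case by (metis fst_conv snd_conv)
  qed
qed

text \<open>A repeated nonloop edge would be a cycle of length 2, and a repeated loop would be a
  second loop. So the graph can be recovered from its edge set, which makes the family finite and
  lets supports identify its members.\<close>

lemma well_structured_eq_mset_set:
  fixes T :: "'v::linorder sgraph"
  assumes ws: "well_structured V T"
  shows "mset_set (set_mset T) = T"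
proof (rule multiset_eqI)
  fix e :: "'v sedge"
  obtain i j s where e: "e = (i, j, s)" by (cases e)
  have "count T e \<le> 1"
  proof (cases "i = j")
    case True
    have "count T e = count {#(i, j, s) \<in># T. i = j#} e" using True e by simp
    also have "\<dots> \<le> size {#(i, j, s) \<in># T. i = j#}" by (rule count_le_size)
    finally show ?thesis using ws unfolding well_structured_def by simp
  next
    case False
    show ?thesis
    proof (rule ccontr)
      assume "\<not> ?thesis"
      then have "{#e, e#} \<subseteq># T" by (intro mset_subset_eqI) auto
      then have "nonloop_cycle T [i, j] [e, e]"
        unfolding nonloop_cycle_def using False by (auto simp: e less_Suc_eq)
      then show False using ws unfolding well_structured_def by blast
    qed
  qed
  then have "count T e = 1" if "e \<in># T"
    using that count_greater_zero_iff[of T e] by linarith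
  then show "count (mset_set (set_mset T)) e = count T e"
    by (cases "e \<in># T") (simp_all add: count_mset_set' not_in_iff)
qed

section \<open>Spanning from connectedness, acyclicity from dimension\<close>

abbreviation edge_relation :: "'v sedge set \<Rightarrow> ('v \<times> 'v) set" where
  "edge_relation E \<equiv> {(x, y). \<exists>e \<in> E. joins e x y}"

lemma joins_sym: "joins e u v \<Longrightarrow> joins e v u"
  by (cases e) auto

text \<open>Common core for signed and unsigned edge vectors: membership of basis vectors spreads
  from the loop vertex along the edges.\<close>

lemma axis_span_connected:
  fixes S :: "(real^'n) set"
  assumes "\<And>v. (m, v) \<in> (edge_relation E)\<^sup>*" "subspace S" "axis m 1 \<in> S"
    and step: "\<And>e u v. e \<in> E \<Longrightarrow> joins e u v \<Longrightarrow> axis u 1 \<in> S \<Longrightarrow> axis v 1 \<in> S"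
  shows "S = UNIV"
proof -
  have "axis v 1 \<in> S" for v
    using assms(1)[of v] by (induction rule: rtrancl_induct) (use assms(3) step in auto)
  then have "Basis \<subseteq> S" by (auto simp: Basis_vec_def)
  then have "span Basis \<subseteq> S" using assms(2) by (rule span_minimal)
  then show ?thesis by auto
qed

lemma span_edge_vectors:
  fixes E :: "'n::{finite,linorder} sedge set"
  assumes con: "\<And>v. (m, v) \<in> (edge_relation E)\<^sup>*" and loop: "(m, m, Positive) \<in> E"
  shows "span (edge_vector ` E) = UNIV"
proof (rule axis_span_connected[OF con])
  have "(1 / 2) *\<^sub>R edge_vector (m, m, Positive) \<in> span (edge_vector ` E)"
    using loop by (intro span_scale span_base) blast
  then show "axis m 1 \<in> span (edge_vector ` E)"
    by (simp add: scaleR_2[symmetric])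
next
  fix e u v assume e: "e \<in> E" "joins e u v" and u: "axis u 1 \<in> span (edge_vector ` E)"
  have ev: "edge_vector e \<in> span (edge_vector ` E)" using e by (intro span_base) blast
  obtain i j s where ijs: "e = (i, j, s)" by (cases e)
  consider "axis v 1 = axis u 1 - edge_vector e" | "axis v 1 = edge_vector e + axis u 1"
    | "axis v 1 = edge_vector e - axis u 1"
    using e(2) edge_sign_cases[of s] unfolding ijs by (auto simp: algebra_simps)
  then show "axis v 1 \<in> span (edge_vector ` E)"
    by cases (auto intro: span_add span_diff u ev)
qed auto

text \<open>The unsigned incidence vectors detect cycles; the signed ones do not, since an odd signed cycle
  may be independent.\<close>

fun graph_vector :: "'n::finite sedge \<Rightarrow> real^'n" where
  "graph_vector (i, j, s) = (if i = j then axis i 1 else axis i 1 - axis j 1)"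

lemma span_graph_vectors:
  fixes E :: "'n::finite sedge set"
  assumes con: "\<And>v. (m, v) \<in> (edge_relation E)\<^sup>*" and loop: "(m, m, Positive) \<in> E"
  shows "span (graph_vector ` E) = UNIV"
proof (rule axis_span_connected[OF con])
  have "graph_vector (m, m, Positive) \<in> span (graph_vector ` E)"
    using loop by (intro span_base) blast
  then show "axis m 1 \<in> span (graph_vector ` E)" by simp
next
  fix e u v assume e: "e \<in> E" "joins e u v" and u: "axis u 1 \<in> span (graph_vector ` E)"
  have ev: "graph_vector e \<in> span (graph_vector ` E)" using e by (intro span_base) blast
  obtain i j s where ijs: "e = (i, j, s)" by (cases e)
  consider "u = v" | "axis v 1 = axis u 1 - graph_vector e" | "axis v 1 = graph_vector e + axis u 1"
    using e(2) unfolding ijs by (cases "i = j") (auto simp: algebra_simps)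
  then show "axis v 1 \<in> span (graph_vector ` E)"
    by cases (use u in \<open>auto intro: span_add span_diff u ev\<close>)
qed auto

text \<open>Around a cycle the unsigned vectors, suitably oriented, telescope: all edges but one add
  up to plus or minus the vector of the remaining edge.\<close>

lemma nonloop_cycle_redundant:
  fixes E :: "'n::finite sedge set"
  assumes "nonloop_cycle (mset_set E) vs es"
  obtains e where "e \<in> E" "graph_vector e \<in> span (graph_vector ` (E - {e}))"
proof -
  let ?n = "length vs"
  have n: "2 \<le> ?n" "length es = ?n" and vs: "distinct vs" and sub: "mset es \<subseteq># mset_set E"
    and joins: "\<And>k. k < ?n \<Longrightarrow> joins (es ! k) (vs ! k) (vs ! (Suc k mod ?n))"
    using assms unfolding nonloop_cycle_def by auto
  \<comment> \<open>Multiplicities in \<open>mset_set E\<close> are at most 1, so the edges of the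
    cycle are distinct as triples and no later one equals the first.\<close>
  have "count (mset es) e = (if e \<in> set es then 1 else 0)" for e
  proof -
    have "count (mset_set E) e \<le> 1" by (simp add: count_mset_set')
    then have "count (mset es) e = 0 \<or> count (mset es) e = 1"
      using mset_subset_eq_count[OF sub, of e] by linarith
    then show ?thesis using count_mset_0_iff[of es e] by metis
  qed
  then have es: "distinct es" unfolding distinct_count_atmost_1 by blast
  have E: "set es \<subseteq> E" using set_mset_mono[OF sub] by simp
  let ?e = "es ! 0"
  let ?S = "span (graph_vector ` (E - {?e}))"
  have e: "?e \<in> E" using n by (intro subsetD[OF E] nth_mem) linarith
  have step: "axis (vs ! k) 1 - axis (vs ! (Suc k mod ?n)) 1 \<in> ?S" if k: "0 < k" "k < ?n" for k
  proof -
    have "es ! k \<in> E - {?e}"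
      using subsetD[OF E nth_mem[of k es]] es n k nth_eq_iff_index_eq[of es k 0] by fastforce
    then have g: "graph_vector (es ! k) \<in> ?S" by (intro span_base) blast
    obtain i j s where ijs: "es ! k = (i, j, s)" by (cases "es ! k")
    consider "axis (vs ! k) 1 - axis (vs ! (Suc k mod ?n)) 1 = (0 :: real^'n)"
      | "axis (vs ! k) 1 - axis (vs ! (Suc k mod ?n)) 1 = graph_vector (es ! k)"
      | "axis (vs ! k) 1 - axis (vs ! (Suc k mod ?n)) 1 = - graph_vector (es ! k)"
      using joins[OF k(2)] unfolding ijs by (cases "i = j") auto
    then show ?thesis by cases (use g span_neg[OF g] span_0 in simp_all)
  qed
  \<comment> \<open>The walk starts at \<open>vs ! 1\<close> and avoids the first edge: for
    \<open>k = 0\<close> the difference is 0, and for \<open>k = ?n - 1\<close> the index wraps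
    round to \<open>vs ! 0\<close>.\<close>
  have "axis (vs ! 1) 1 - axis (vs ! (Suc k mod ?n)) 1 \<in> ?S" if "k < ?n" for k
    using that
  proof (induction k)
    case 0
    then show ?case using n by (simp add: span_0)
  next
    case (Suc k)
    have "(axis (vs ! 1) 1 - axis (vs ! (Suc k mod ?n)) 1) +
        (axis (vs ! Suc k) 1 - axis (vs ! (Suc (Suc k) mod ?n)) 1) \<in> ?S"
      using Suc by (intro span_add step) auto
    then show ?case using Suc.prems by simp
  qed
  moreover have "Suc (?n - 1) = ?n" "?n - 1 < ?n" using n by linarith+
  ultimately have s: "axis (vs ! 1) 1 - axis (vs ! 0) 1 \<in> ?S" by (metis mod_self)
  obtain i j t where ijt: "?e = (i, j, t)" by (cases "?e")
  have "vs ! 0 \<noteq> vs ! 1"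
  proof -
    have "0 < ?n" "1 < ?n" using n by linarith+
    then show ?thesis using nth_eq_iff_index_eq[OF vs, of 0 1] by simp
  qed
  moreover have "joins ?e (vs ! 0) (vs ! 1)"
  proof -
    have "0 < ?n" "1 < ?n" using n by linarith+
    then show ?thesis using joins[of 0] by simp
  qed
  ultimately consider "graph_vector ?e = axis (vs ! 1) 1 - axis (vs ! 0) 1"
    | "graph_vector ?e = - (axis (vs ! 1) 1 - axis (vs ! 0) 1)"
    unfolding ijt by (cases "i = j") auto
  then have "graph_vector ?e \<in> ?S"
    by cases (use s span_neg[OF s] in simp_all)
  then show thesis using that e by blast
qed

lemma connected_graph_reachable:
  "connected_graph UNIV T \<Longrightarrow> (m, v) \<in> (edge_relation (set_mset T))\<^sup>*"
  unfolding connected_graph_def by blast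

lemma well_structured_span:
  fixes T :: "'n::{finite,linorder} sgraph"
  assumes "well_structured UNIV T"
  shows "span (edge_vector ` set_mset T) = UNIV"
proof -
  have con: "connected_graph UNIV T" and loops: "size {#(i, j, s) \<in># T. i = j#} = 1"
    and sg: "signed_graph UNIV T"
    using assms unfolding well_structured_def by blast+
  obtain l where l: "{#(i, j, s) \<in># T. i = j#} = {#l#}"
    using loops size_1_singleton_mset by metis
  have "l \<in># {#(i, j, s) \<in># T. i = j#}" unfolding l by simp
  then obtain m s where "(m, m, s) \<in># T" by auto
  then have "(m, m, Positive) \<in># T" using sg unfolding signed_graph_def by fastforce
  then show ?thesis using span_edge_vectors connected_graph_reachable[OF con] by blast
qed

lemma card_edges:
  fixes E :: "'n::{finite,linorder} sedge set"
  assumes "admissible E" "span (edge_vector ` E) = UNIV"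
  shows "card E = CARD('n)"
proof -
  have "card (edge_vector ` E) = dim (UNIV :: (real^'n::_) set)"
    using independent_edge_vectors[OF assms(1)] assms(2) by (metis dim_span dim_eq_card_independent)
  then show ?thesis using card_image[OF inj_on_edge_vector[OF assms(1)]] by simp
qed

lemma well_structured_simplex:
  fixes T :: "'n::{finite,linorder} sgraph"
  assumes "well_structured UNIV T" "alternating T"
  shows "int CARD('n) simplex root_polytope T"
proof -
  have ad: "admissible (set_mset T)" using assms by (rule well_structured_admissible)
  let ?V = "edge_vector ` set_mset T"
  have "card ?V = CARD('n)"
    using card_edges[OF ad well_structured_span[OF assms(1)]] card_image[OF inj_on_edge_vector[OF ad]]
    by simp
  then have "card (insert 0 ?V) = CARD('n) + 1"
    using affine_independent_edge_vectors(2)[OF ad] by simp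
  then show ?thesis unfolding simplex_def root_polytope_eq[OF ad]
    using affine_independent_edge_vectors(1)[OF ad] by (intro exI[of _ "insert 0 ?V"]) simp
qed

text \<open>Acyclicity comes from counting. The signed vectors are independent and spanning, so
  \<open>E\<close> has exactly n edges; the unsigned vectors of the connected graph span too, and a
  cycle would make one of these n vectors redundant.\<close>

lemma well_structuredI:
  fixes E :: "'n::{finite,linorder} sedge set"
  assumes ad: "admissible E" and loop: "(m, m, Positive) \<in> E"
    and con: "\<And>v. (m, v) \<in> (edge_relation E)\<^sup>*"
  shows "well_structured UNIV (mset_set E)" "alternating (mset_set E)"
proof -
  have set: "set_mset (mset_set E) = E" by simp
  have fst: "e = (m, m, Positive)" if e: "e \<in> E" "fst e = fst (snd e)" for e
  proof -
    obtain i s where i: "e = (i, i, s)" using e(2) by (cases e) simp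
    have s: "s = Positive" using admissible_edge(2)[OF ad, of i i s] e(1) i by simp
    then show ?thesis using admissible_loop_unique[OF ad loop, of i] e(1) i by simp
  qed
  have "{#(i, j, s) \<in># mset_set E. i = j#} = mset_set {e \<in> E. fst e = fst (snd e)}"
    by (simp add: filter_mset_mset_set case_prod_unfold)
  also have "{e \<in> E. fst e = fst (snd e)} = {(m, m, Positive)}"
  proof (intro equalityI subsetI)
    fix e assume "e \<in> {e \<in> E. fst e = fst (snd e)}"
    then have "e = (m, m, Positive)" by (intro fst) blast+
    then show "e \<in> {(m, m, Positive)}" by simp
  qed (use loop in auto)
  finally have loops: "size {#(i, j, s) \<in># mset_set E. i = j#} = 1" by simp
  have con': "connected_graph UNIV (mset_set E)"
    unfolding connected_graph_def set
  proof (intro ballI)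
    fix u v
    have "sym (edge_relation E)" by (intro symI) (auto intro: joins_sym)
    then have "(u, m) \<in> (edge_relation E)\<^sup>*" by (rule symD[OF sym_rtrancl con])
    then show "(u, v) \<in> (edge_relation E)\<^sup>*" using con[of v] by (rule rtrancl_trans)
  qed
  have acyc: "\<not> (\<exists>vs es. nonloop_cycle (mset_set E) vs es)"
  proof
    assume "\<exists>vs es. nonloop_cycle (mset_set E) vs es"
    then obtain e where e: "e \<in> E" "graph_vector e \<in> span (graph_vector ` (E - {e}))"
      using nonloop_cycle_redundant by metis
    then have "graph_vector ` E \<subseteq> span (graph_vector ` (E - {e}))"
      by (auto intro: span_base)
    then have "UNIV \<subseteq> span (graph_vector ` (E - {e}))"
      using span_graph_vectors[OF con loop] span_minimal subspace_span by metis
    then have "CARD('n) \<le> card (graph_vector ` (E - {e}))"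
      by (drule_tac dim_le_card) simp_all
    also have "\<dots> \<le> card (E - {e})" by (intro card_image_le) simp
    also have "\<dots> < card E" using e(1) by (intro psubset_card_mono) auto
    also have "\<dots> = CARD('n)" using card_edges[OF ad span_edge_vectors[OF con loop]] .
    finally show False by simp
  qed
  show "alternating (mset_set E)"
    unfolding alternating_def set using admissible_alternating[OF ad] by blast
  show "well_structured UNIV (mset_set E)"
    unfolding well_structured_def
  proof (intro conjI acyc con' loops, goal_cases)
    case 1
    show ?case unfolding signed_graph_def set using admissible_edge[OF ad] by fast
  next
    case 2
    show ?case unfolding noncrossing_def set using admissible_noncrossing[OF ad] by (meson not_le)
  next
    case 3
    show ?case unfolding set using admissible_Positive[OF ad] by blast
  next
    case 4
    show ?case unfolding set using admissible_loop_Positive[OF ad] by blast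
  next
    case 5
    show ?case unfolding set using admissible_loop_Negative[OF ad] by (meson not_le)
  next
    case 6
    show ?case unfolding set using admissible_Positive_Negative[OF ad] by (meson not_le)
  qed
qed

section \<open>Generic vectors and the triangulation\<close>

text \<open>Coefficients -1, 0, 1 cover all functionals needed: those annihilating a loopless or
  disconnected support, the coordinates and their differences, and the prefix sums of signed
  rearrangements. There are finitely many, so nongeneric vectors lie in finitely many
  hyperplanes.\<close>

definition generic :: "real^'n::finite \<Rightarrow> bool" where
  "generic x \<longleftrightarrow> (\<forall>\<delta>. (\<forall>i. \<delta> i \<in> {-1, 0, 1}) \<and> (\<exists>i. \<delta> i \<noteq> 0) \<longrightarrow> (\<Sum>i\<in>UNIV. \<delta> i * x $ i) \<noteq> 0)"

lemma negligible_nongeneric: "negligible {x :: real^'n::finite. \<not> generic x}"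
proof -
  let ?D = "{\<delta> :: 'n \<Rightarrow> real. (\<forall>i. \<delta> i \<in> {-1, 0, 1}) \<and> (\<exists>i. \<delta> i \<noteq> 0)}"
  have "?D \<subseteq> PiE UNIV (\<lambda>_. {-1, 0, 1})" by (auto simp: PiE_def)
  then have fin: "finite ?D" by (rule finite_subset) (simp add: finite_PiE)
  have "negligible (\<Union>\<delta>\<in>?D. {x :: real^'n. (\<chi> i. \<delta> i) \<bullet> x = 0})"
  proof (intro negligible_Union ballI)
    fix S assume "S \<in> (\<lambda>\<delta>. {x :: real^'n. (\<chi> i. \<delta> i) \<bullet> x = 0}) ` ?D"
    then obtain \<delta> where \<delta>: "\<delta> \<in> ?D"
        and S: "S = {x :: real^'n. (\<chi> i. \<delta> i) \<bullet> x = 0}" by blast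
    have "(\<chi> i. \<delta> i) \<noteq> (0 :: real^'n)" using \<delta> by (auto simp: vec_eq_iff)
    then show "negligible S" unfolding S by (intro negligible_hyperplane) simp
  qed (use fin in simp)
  then show ?thesis
    by (rule negligible_subset) (auto simp: generic_def inner_vec_def)
qed

text \<open>The assumption says that the functional \<open>\<delta>\<close> vanishes on every
  support edge vector. A nonzero such \<open>\<delta>\<close> with values in -1, 0, 1 contradicts
  genericity.\<close>

lemma represents_annihilated:
  fixes x :: "real^'n::{finite,linorder}"
  assumes rep: "represents c x"
    and z: "\<And>i j s. c (i, j, s) \<noteq> 0 \<Longrightarrow> \<delta> i + (if s = Negative then - \<delta> j else \<delta> j) = 0"
  shows "(\<Sum>i\<in>UNIV. \<delta> i * x $ i) = 0"
proof -
  have ev: "(\<Sum>v\<in>UNIV. \<delta> v * edge_vector (i, j, s) $ v) = \<delta> i + (if s = Negative then - \<delta> j else \<delta> j)"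
    for i j :: 'n and s
  proof -
    have "\<delta> v * edge_vector (i, j, s) $ v = (if v = i then \<delta> v else 0) +
        (if v = j then (if s = Negative then - \<delta> v else \<delta> v) else 0)" for v
      unfolding edge_vector_nth by auto
    then show ?thesis by (simp add: sum.distrib)
  qed
  have "(\<Sum>i\<in>UNIV. \<delta> i * x $ i) = (\<Sum>e\<in>UNIV. c e * (\<Sum>v\<in>UNIV. \<delta> v * edge_vector e $ v))"
    unfolding represents_nth[OF rep] sum_distrib_left
    by (subst sum.swap) (simp add: mult.left_commute)
  also have "\<dots> = 0"
  proof (intro sum.neutral ballI)
    fix e :: "'n sedge"
    obtain i j s where e: "e = (i, j, s)" by (cases e)
    show "c e * (\<Sum>v\<in>UNIV. \<delta> v * edge_vector e $ v) = 0"
      unfolding e ev using z[of i j s] by (cases "c (i, j, s) = 0") simp_all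
  qed
  finally show ?thesis .
qed

text \<open>Without loops, all left ends of positive edges precede all right ends, so one cut
  separates them. A negative edge passing over the cut would cross or cover a positive edge, or
  violate alternation. Opposite signs on the two sides of the cut then annihilate the
  support.\<close>

lemma generic_loop:
  fixes x :: "real^'n::{finite,linorder}"
  assumes rep: "represents c x" and gen: "generic x"
  obtains m where "c (m, m, Positive) \<noteq> 0"
proof (rule ccontr)
  assume "\<not> thesis"
  with that have noloop: "c (m, m, Positive) = 0" for m by blast
  have ad: "admissible {e. c e \<noteq> 0}" using rep unfolding represents_def by auto
  note re = represents_endpoints[OF rep]
  have pos: "p < q" if "c (p, q, s) \<noteq> 0" for p q s
    using re(1,2)[OF that] noloop[of p] that by (cases "p = q") auto
  define R where "R = {q. \<exists>p. c (p, q, Positive) \<noteq> 0}"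
  define \<delta> where "\<delta> i = (if \<exists>r\<in>R. r \<le> i then -1 else 1 :: real)" for i
  have "(\<Sum>i\<in>UNIV. \<delta> i * x $ i) = 0"
  proof (rule represents_annihilated[OF rep])
    fix i j s assume c: "c (i, j, s) \<noteq> 0"
    show "\<delta> i + (if s = Negative then - \<delta> j else \<delta> j) = 0"
    proof (cases s)
      case Positive
      have "\<delta> j = -1" using c Positive unfolding \<delta>_def R_def by auto
      moreover have "\<delta> i = 1"
      proof -
        have "\<not> r \<le> i" if "r \<in> R" for r
        proof -
          obtain p where p: "c (p, r, Positive) \<noteq> 0" using \<open>r \<in> R\<close> unfolding R_def by blast
          have "i < r"
            using admissible_Positive(1)[OF ad, of i j p r] p c Positive pos[OF p] pos[OF c] by simp
          then show ?thesis by simp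
        qed
        then show ?thesis unfolding \<delta>_def by auto
      qed
      ultimately show ?thesis using Positive by simp
    next
      case Negative
      have "(\<exists>r\<in>R. r \<le> i) \<longleftrightarrow> (\<exists>r\<in>R. r \<le> j)"
      proof
        assume "\<exists>r\<in>R. r \<le> i"
        then show "\<exists>r\<in>R. r \<le> j" using pos[OF c] by (meson order_trans less_imp_le)
      next
        assume "\<exists>r\<in>R. r \<le> j"
        then obtain r p where r: "c (p, r, Positive) \<noteq> 0" "r \<le> j" "r \<in> R"
            unfolding R_def by blast
        have "r \<le> i"
        proof (rule ccontr)
          assume "\<not> r \<le> i"
          then have ir: "i < r" by simp
          have "r \<noteq> j" using re(4)[OF r(1)] re(5)[OF c] Negative by auto
          then have rj: "r < j" using r(2) by simp
          show False
          proof (cases "i \<le> p")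
            case True
            then show False
              using admissible_Positive_Negative[OF ad, of p r i j] r(1) c Negative pos[OF r(1)] rj
                  by auto
          next
            case False
            then show False
              using admissible_noncrossing[OF ad, of p r Positive i j s] r(1) c ir rj
                  by (auto simp: not_le)
          qed
        qed
        then show "\<exists>r\<in>R. r \<le> i" using r by blast
      qed
      then show ?thesis unfolding \<delta>_def using Negative by simp
    qed
  qed
  moreover have "\<forall>i. \<delta> i \<in> {-1, 0, 1}" "\<exists>i. \<delta> i \<noteq> 0"
      unfolding \<delta>_def by auto
  ultimately show False using gen unfolding generic_def by blast
qed

text \<open>Outside the component of \<open>m\<close>, the two loop conditions make positive edges
  straddle \<open>m\<close> and keep negative edges on one side of it. So the functional that is 0
  on the component, 1 to the left of \<open>m\<close> and -1 to the right annihilates the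
  support.\<close>

lemma generic_connected:
  fixes x :: "real^'n::{finite,linorder}"
  assumes rep: "represents c x" and gen: "generic x" and m: "c (m, m, Positive) \<noteq> 0"
  shows "(m, v) \<in> (edge_relation {e. c e \<noteq> 0})\<^sup>*"
proof (rule ccontr)
  let ?R = "edge_relation {e. c e \<noteq> 0}"
  assume v: "(m, v) \<notin> ?R\<^sup>*"
  have ad: "admissible {e. c e \<noteq> 0}" using rep unfolding represents_def by auto
  note re = represents_endpoints[OF rep]
  define \<delta>
      where "\<delta> i = (if (m, i) \<in> ?R\<^sup>* then 0 else if i < m then 1 else -1 :: real)"
          for i
  have "(\<Sum>i\<in>UNIV. \<delta> i * x $ i) = 0"
  proof (rule represents_annihilated[OF rep])
    fix i j s assume c: "c (i, j, s) \<noteq> 0"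
    have "joins (i, j, s) i j" "joins (i, j, s) j i" by auto
    then have ij: "(i, j) \<in> ?R" "(j, i) \<in> ?R" using c by blast+
    then have iff: "(m, i) \<in> ?R\<^sup>* \<longleftrightarrow> (m, j) \<in> ?R\<^sup>*"
        by (meson rtrancl.rtrancl_into_rtrancl)
    show "\<delta> i + (if s = Negative then - \<delta> j else \<delta> j) = 0"
    proof (cases "(m, i) \<in> ?R\<^sup>*")
      case True
      then show ?thesis using iff unfolding \<delta>_def by simp
    next
      case False
      then have ne: "i \<noteq> m" "j \<noteq> m" using iff by auto
      show ?thesis
      proof (cases s)
        case Positive
        have "i \<noteq> j"
          using admissible_loop_unique[OF ad, of m i] m c Positive ne by auto
        then have "i < j" using re(1)[OF c] by simp
        then have "i \<le> m" "m \<le> j"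
          using admissible_loop_Positive[OF ad, of m i j] m c Positive by auto
        then have "i < m" "\<not> j < m" using ne by auto
        then show ?thesis using False iff Positive unfolding \<delta>_def by simp
      next
        case Negative
        have "i < j" using re(6)[OF c] Negative by simp
        then have "i < m \<longleftrightarrow> j < m"
          using admissible_loop_Negative[OF ad, of m i j] m c Negative ne by auto
        then show ?thesis using False iff Negative unfolding \<delta>_def by simp
      qed
    qed
  qed
  moreover have "\<forall>i. \<delta> i \<in> {-1, 0, 1}" "\<exists>i. \<delta> i \<noteq> 0"
      unfolding \<delta>_def using v by auto
  ultimately show False using gen unfolding generic_def by blast
qed

lemma represents_in_hull:
  fixes x :: "real^'n::{finite,linorder}"
  assumes rep: "represents c x" and l1: "(\<Sum>v\<in>UNIV. \<bar>x $ v\<bar>) \<le> 2"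
  shows "x \<in> convex hull (insert 0 (edge_vector ` {e. c e \<noteq> 0}))"
proof -
  let ?S = "{e. c e \<noteq> 0}" and ?H = "convex hull (insert 0 (edge_vector ` {e. c e \<noteq> 0}))"
  have nn: "\<And>e. 0 \<le> c e" and x: "x = (\<Sum>e\<in>UNIV. c e *\<^sub>R edge_vector e)"
    using rep unfolding represents_def by auto
  have "(\<Sum>e\<in>UNIV. c e) \<le> 1" using represents_l1[OF rep] l1 by simp
  moreover have "(\<Sum>e\<in>UNIV. c e) = (\<Sum>e\<in>?S. c e)" by (rule sum.mono_neutral_right) auto
  ultimately have le: "(\<Sum>e\<in>?S. c e) \<le> 1" by simp
  have x': "x = (\<Sum>e\<in>?S. c e *\<^sub>R edge_vector e)"
    unfolding x by (rule sum.mono_neutral_right) auto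
  \<comment> \<open>The missing weight is placed on the origin; option indices keep it apart from
    the edges without any injectivity of \<open>edge_vector\<close>.\<close>
  define d where "d o' = (case o' of None \<Rightarrow> 1 - (\<Sum>e\<in>?S. c e) | Some e \<Rightarrow> c e)" for o'
  define f where "f o' = (case o' of None \<Rightarrow> 0 | Some e \<Rightarrow> edge_vector e)"
      for o' :: "'n sedge option"
  have "(\<Sum>o'\<in>insert None (Some ` ?S). d o' *\<^sub>R f o') \<in> ?H"
  proof (rule convex_sum)
    show "convex ?H" by (rule convex_convex_hull)
    show "sum d (insert None (Some ` ?S)) = 1" by (simp add: sum.reindex d_def)
    fix o' assume "o' \<in> insert None (Some ` ?S)"
    then show "0 \<le> d o'" using nn le by (auto simp: d_def)
    show "f o' \<in> ?H" using \<open>o' \<in> _\<close> by (auto simp: f_def intro!: hull_inc)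
  qed simp
  moreover have "(\<Sum>o'\<in>insert None (Some ` ?S). d o' *\<^sub>R f o') = x"
    unfolding x' by (simp add: sum.reindex d_def f_def)
  ultimately show ?thesis by simp
qed

section \<open>Inequalities for the full polytope and the covering argument\<close>

lemma full_root_polytope_eq:
  "(full_root_polytope :: (real^'n::{finite,linorder}) set) =
    {x. dominant x \<and> (\<Sum>v\<in>UNIV. \<bar>x $ v\<bar>) \<le> 2}" (is "_ = ?P")
proof (intro equalityI subsetI)
  fix x :: "real^'n::_" assume "x \<in> ?P"
  then have x: "dominant x" "(\<Sum>v\<in>UNIV. \<bar>x $ v\<bar>) \<le> 2" by auto
  then obtain c where c: "represents c x" using dominant_imp_represents by blast
  have "edge_vector ` {e. c e \<noteq> 0} \<subseteq> positive_roots"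
    unfolding positive_roots_eq using represents_endpoints(1,2)[OF c] by blast
  then have "convex hull (insert 0 (edge_vector ` {e. c e \<noteq> 0})) \<subseteq> full_root_polytope"
    unfolding full_root_polytope_def by (intro hull_mono) auto
  then show "x \<in> full_root_polytope" using represents_in_hull[OF c x(2)] by blast
next
  have "convex ?P"
  proof (rule convexI)
    fix x y :: "real^'n::_" and a b :: real
    assume x: "x \<in> ?P" and y: "y \<in> ?P" and ab: "0 \<le> a" "0 \<le> b" "a + b = 1"
    have "(\<Sum>v\<in>UNIV. \<bar>(a *\<^sub>R x + b *\<^sub>R y) $ v\<bar>) \<le> (\<Sum>v\<in>UNIV. a * \<bar>x $ v\<bar> + b * \<bar>y $ v\<bar>)"
    proof (rule sum_mono)
      show "\<bar>(a *\<^sub>R x + b *\<^sub>R y) $ v\<bar> \<le> a * \<bar>x $ v\<bar> + b * \<bar>y $ v\<bar>" for v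
        using abs_triangle_ineq[of "a * x $ v" "b * y $ v"] ab by (simp add: abs_mult)
    qed
    also have "\<dots> = a * (\<Sum>v\<in>UNIV. \<bar>x $ v\<bar>) + b * (\<Sum>v\<in>UNIV. \<bar>y $ v\<bar>)"
      by (simp add: sum.distrib sum_distrib_left)
    also have "\<dots> \<le> a * 2 + b * 2"
      using x y ab by (intro add_mono mult_left_mono) auto
    also have "\<dots> = 2" using ab by simp
    finally show "a *\<^sub>R x + b *\<^sub>R y \<in> ?P"
      using x y ab by (auto intro!: dominant_add dominant_scale)
  qed
  moreover have "insert 0 positive_roots \<subseteq> ?P"
    unfolding positive_roots_eq
    by (auto simp: edge_vector_l1 dominant_edge_vector simp del: edge_vector.simps) (simp add: dominant_def)
  ultimately have "full_root_polytope \<subseteq> ?P"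
    unfolding full_root_polytope_def by (rule hull_minimal[rotated])
  then show "x \<in> ?P" if "x \<in> full_root_polytope" for x using that by blast
qed

lemma aff_dim_full_root_polytope:
  "aff_dim (full_root_polytope :: (real^'n::{finite,linorder}) set) = int CARD('n)"
proof -
  have "axis i 1 \<in> span (positive_roots :: (real^'n::_) set)" for i
  proof -
    have "2 *\<^sub>R axis i 1 \<in> (positive_roots :: (real^'n::_) set)"
      unfolding positive_roots_def by blast
    then have "(1 / 2) *\<^sub>R 2 *\<^sub>R axis i 1 \<in> span (positive_roots :: (real^'n::_) set)"
      by (intro span_scale span_base)
    then show ?thesis by simp
  qed
  then have "Basis \<subseteq> span (positive_roots :: (real^'n::_) set)"
    by (auto simp: Basis_vec_def)
  then have "span Basis \<subseteq> span (positive_roots :: (real^'n::_) set)"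
    by (intro span_minimal) auto
  then have "span (positive_roots :: (real^'n::_) set) = UNIV" by auto
  then have "dim (insert 0 positive_roots :: (real^'n::_) set) = CARD('n)"
    by (metis dim_span span_insert_0 dim_UNIV DIM_cart DIM_real mult_1_right)
  then show ?thesis
    unfolding full_root_polytope_def aff_dim_convex_hull
    by (subst aff_dim_zero) (auto intro: hull_inc)
qed

lemma generic_in_root_polytope:
  fixes x :: "real^'n::{finite,linorder}"
  assumes gen: "generic x" and x: "x \<in> full_root_polytope"
  obtains T where "well_structured UNIV T" "alternating T" "x \<in> root_polytope T"
proof -
  have dom: "dominant x" and l1: "(\<Sum>v\<in>UNIV. \<bar>x $ v\<bar>) \<le> 2"
    using x unfolding full_root_polytope_eq by auto
  obtain c where rep: "represents c x" using dominant_imp_represents[OF dom] by blast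
  let ?E = "{e. c e \<noteq> 0}"
  have ad: "admissible ?E" using rep unfolding represents_def by auto
  obtain m where m: "c (m, m, Positive) \<noteq> 0" using generic_loop[OF rep gen] .
  have "(m, m, Positive) \<in> ?E" using m by simp
  note ws = well_structuredI[OF ad this generic_connected[OF rep gen m]]
  have "x \<in> root_polytope (mset_set ?E)"
    using represents_in_hull[OF rep l1] root_polytope_eq[of "mset_set ?E"] ad by simp
  then show thesis using that ws by blast
qed

theorem root_polytope_triangulation:
  fixes \<T> :: "'n::{finite,linorder} sgraph set"
  assumes \<T>: "\<T> = {T. well_structured UNIV T \<and> alternating T}"
  shows "central_triangulation (positive_roots :: (real^'n::_) set) \<T> root_polytope"
proof -
  have ad: "admissible (set_mset T)" if "T \<in> \<T>" for T
    using that well_structured_admissible unfolding \<T> by blast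
  have eq: "T = U" if "T \<in> \<T>" "U \<in> \<T>" "set_mset T = set_mset U" for T U
    using that well_structured_eq_mset_set unfolding \<T> by (metis mem_Collect_eq)
  have fin: "finite \<T>"
  proof (rule finite_imageD)
    show "inj_on set_mset \<T>" using eq by (intro inj_onI) blast
    show "finite (set_mset ` \<T>)" by (rule finite_subset[of _ "Pow UNIV"]) (blast, simp del: Pow_UNIV)
  qed
  have smplx: "int CARD('n) simplex root_polytope T" if "T \<in> \<T>" for T
    using that well_structured_simplex unfolding \<T> by blast
  have ext: "y extreme_point_of root_polytope T \<longleftrightarrow> y = 0 \<or> y \<in> edge_vector ` set_mset T"
    if "T \<in> \<T>" for T y
    unfolding root_polytope_eq[OF ad[OF that]]
    using extreme_point_of_convex_hull_affine_independent[OF affine_independent_edge_vectors(1)[OF ad[OF that]]]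
    by simp
  have roots: "edge_vector ` set_mset T \<subseteq> positive_roots" if "T \<in> \<T>" for T
    using positive_roots_Int_graph_cone[OF ad[OF that]] by blast
  have disj: "disjoint_family_on (\<lambda>T. rel_interior (root_polytope T)) \<T>"
    unfolding disjoint_family_on_def
  proof (intro ballI impI, rule ccontr)
    fix T U assume TU: "T \<in> \<T>" "U \<in> \<T>" "T \<noteq> U"
      "rel_interior (root_polytope T) \<inter> rel_interior (root_polytope U) \<noteq> {}"
    then obtain x
        where x: "x \<in> rel_interior (root_polytope T)" "x \<in> rel_interior (root_polytope U)"
            by blast
    obtain c where c: "represents c x" "{e. c e \<noteq> 0} = set_mset T"
      using rel_interior_root_polytope[OF ad[OF TU(1)] x(1)] .
    obtain d where d: "represents d x" "{e. d e \<noteq> 0} = set_mset U"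
      using rel_interior_root_polytope[OF ad[OF TU(2)] x(2)] .
    have "c = d" using c(1) d(1) by (rule represents_unique)
    then show False using c(2) d(2) eq[OF TU(1,2)] TU(3) by simp
  qed
  let ?P = "full_root_polytope :: (real^'n::_) set" and ?U = "\<Union>T\<in>\<T>. root_polytope T"
  have sub: "?U \<subseteq> ?P"
    unfolding root_polytope_def full_root_polytope_def by (intro UN_least hull_mono) auto
  have compact: "compact (root_polytope T)" if "T \<in> \<T>" for T
    unfolding root_polytope_eq[OF ad[OF that]] by (intro finite_imp_compact_convex_hull) simp
  have "closed ?U" using fin compact by (intro closed_UN compact_imp_closed) auto
  have cP: "convex ?P" unfolding full_root_polytope_def by (rule convex_convex_hull)
  have "aff_dim ?P = int DIM(real^'n::_)" using aff_dim_full_root_polytope by simp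
  then have "affine hull ?P = UNIV" using aff_dim_eq_full by blast
  moreover have "?P \<noteq> {}" unfolding full_root_polytope_def by simp
  ultimately have int: "interior ?P \<noteq> {}"
    using rel_interior_eq_empty[OF cP] rel_interior_interior by metis
  \<comment> \<open>Generic points are covered, so the uncovered part of the interior is negligible;
    it is also open, since \<open>?U\<close> is closed, and hence empty. Taking closures reaches the
    boundary.\<close>
  have "interior ?P - ?U \<subseteq> {x. \<not> generic x}"
    using generic_in_root_polytope interior_subset[of ?P] unfolding \<T> by blast
  then have "negligible (interior ?P - ?U)" using negligible_nongeneric negligible_subset by blast
  moreover have "open (interior ?P - ?U)" using \<open>closed ?U\<close> by (intro open_Diff) auto
  ultimately have "interior ?P \<subseteq> ?U" using open_not_negligible by blast
  then have "closure (interior ?P) \<subseteq> ?U" using \<open>closed ?U\<close> by (rule closure_minimal)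
  then have "?P \<subseteq> ?U" using convex_closure_interior[OF cP int] closure_subset[of ?P] by blast
  then have un: "?U = ?P" using sub by blast
  show ?thesis
    unfolding central_triangulation_def
  proof (intro conjI ballI allI impI fin disj)
    show "?U = convex hull insert 0 positive_roots" using un unfolding full_root_polytope_def .
    show "aff_dim (convex hull insert 0 (positive_roots :: (real^'n::_) set)) simplex root_polytope T"
      if "T \<in> \<T>" for T
      using aff_dim_full_root_polytope smplx[OF that] unfolding full_root_polytope_def by metis
    show "0 extreme_point_of root_polytope T" if "T \<in> \<T>" for T
      using ext[OF that] by blast
    show "y = 0 \<or> y \<in> positive_roots" if "T \<in> \<T>" "y extreme_point_of root_polytope T"
        for T y
      using ext[OF that(1)] that(2) roots[OF that(1)] by blast
  qed
qed

section \<open>Signed arrangements with positive prefix sums\<close>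

text \<open>Lists carry no index set, so the pieces of a cut list are again arrangements of subsets
  of \<open>A\<close>.\<close>

definition signed_arrangements :: "real set \<Rightarrow> real list set" where
  "signed_arrangements A = {ys. distinct (map abs ys) \<and> set (map abs ys) = A}"

definition positive_arrangements :: "real set \<Rightarrow> real list set" where
  "positive_arrangements A =
     {ys \<in> signed_arrangements A. \<forall>k \<in> {1..length ys}. 0 < sum_list (take k ys)}"

text \<open>\<open>generic\<close> restated for a set of positive reals; in this form it is
  inherited by subsets, as the induction over subsets requires.\<close>

definition generic_weights :: "real set \<Rightarrow> bool" where
  "generic_weights A \<longleftrightarrow> finite A \<and> A \<subseteq> {0<..} \<and>
     (\<forall>s. (\<forall>a\<in>A. s a \<in> {-1, 0, 1}) \<and> (\<exists>a\<in>A. s a \<noteq> 0) \<longrightarrow> (\<Sum>a\<in>A. s a * a) \<noteq> 0)"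

lemma generic_weightsD:
  assumes "generic_weights A" "\<And>a. a \<in> A \<Longrightarrow> s a \<in> {-1, 0, 1}" "a \<in> A" "s a \<noteq> 0"
  shows "(\<Sum>a\<in>A. s a * a) \<noteq> 0"
  using assms unfolding generic_weights_def by blast

lemma generic_weights_subset:
  assumes "generic_weights A" "B \<subseteq> A"
  shows "generic_weights B"
  unfolding generic_weights_def
proof (intro conjI allI impI)
  show fin: "finite B" "B \<subseteq> {0<..}"
    using assms finite_subset unfolding generic_weights_def by blast+
  fix s :: "real \<Rightarrow> real" assume s: "(\<forall>a\<in>B. s a \<in> {-1, 0, 1}) \<and> (\<exists>a\<in>B. s a \<noteq> 0)"
  let ?s = "\<lambda>a. if a \<in> B then s a else 0"
  have "(\<Sum>a\<in>A. ?s a * a) = (\<Sum>a\<in>B. s a * a)"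
    using assms unfolding generic_weights_def by (intro sum.mono_neutral_cong_right) auto
  moreover have "(\<Sum>a\<in>A. ?s a * a) \<noteq> 0"
  proof -
    obtain b where "b \<in> B" "s b \<noteq> 0" using s by blast
    then show ?thesis
      using s assms(2) by (intro generic_weightsD[OF assms(1), where a = b]) auto
  qed
  ultimately show "(\<Sum>a\<in>B. s a * a) \<noteq> 0" by simp
qed

lemma generic_weights_sum_list:
  assumes gen: "generic_weights A"
      and ys: "distinct (map abs ys)" "set (map abs ys) \<subseteq> A" "ys \<noteq> []"
  shows "sum_list ys \<noteq> 0"
proof -
  \<comment> \<open>The sign with which \<open>a\<close> occurs in \<open>ys\<close>, and 0 if it
    does not occur; distinct absolute values exclude both signs at once.\<close>
  define s where "s a = (if a \<in> set ys then 1 else if - a \<in> set ys then -1 else 0 :: real)"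
      for a
  have A: "finite A" "A \<subseteq> {0<..}" using gen unfolding generic_weights_def by auto
  have inj: "inj_on abs (set ys)" and dist: "distinct ys" using ys(1) by (auto simp: distinct_map)
  have val: "s \<bar>y\<bar> * \<bar>y\<bar> = y" if y: "y \<in> set ys" for y
  proof (cases "0 \<le> y")
    case True
    then show ?thesis using y by (simp add: s_def)
  next
    case False
    then have "- y \<notin> set ys" using inj_onD[OF inj, of y "- y"] y by auto
    then show ?thesis using y False by (simp add: s_def)
  qed
  have "(\<Sum>a\<in>A. s a * a) = (\<Sum>a\<in>abs ` set ys. s a * a)"
  proof (rule sum.mono_neutral_right)
    show "\<forall>a\<in>A - abs ` set ys. s a * a = 0"
    proof
      fix a assume a: "a \<in> A - abs ` set ys"
      then have "0 < a" using A by auto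
      then have "\<bar>a\<bar> = a" "\<bar>- a\<bar> = a" by simp_all
      then have "a \<notin> set ys" "- a \<notin> set ys" using a by (metis Diff_iff image_eqI)+
      then show "s a * a = 0" by (simp add: s_def)
    qed
  qed (use A ys in auto)
  also have "\<dots> = (\<Sum>y\<in>set ys. s \<bar>y\<bar> * \<bar>y\<bar>)"
      by (simp add: sum.reindex[OF inj])
  also have "\<dots> = sum_list ys"
      using val sum_list_distinct_conv_sum_set[OF dist, of "\<lambda>y. y"] by simp
  finally have eq: "(\<Sum>a\<in>A. s a * a) = sum_list ys" .
  have "hd ys \<in> set ys" using ys(3) by simp
  then have h: "\<bar>hd ys\<bar> \<in> A" "s \<bar>hd ys\<bar> * \<bar>hd ys\<bar> = hd ys"
      using ys(2) val by auto
  then have "hd ys \<noteq> 0" using A by auto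
  then have "s \<bar>hd ys\<bar> \<noteq> 0" using h(2) by auto
  moreover have "s a \<in> {-1, 0, 1}" for a by (simp add: s_def)
  ultimately show ?thesis using generic_weightsD[OF gen _ h(1), of s] eq by auto
qed

lemma card_signed_arrangements:
  assumes "finite A" "A \<subseteq> {0<..}"
  shows "card (signed_arrangements A) = 2 ^ card A * fact (card A)"
proof -
  let ?S = "{ss :: real list. set ss \<subseteq> {1, -1} \<and> length ss = card A}"
  let ?f = "\<lambda>ys :: real list. (map abs ys, map sgn ys)"
  let ?g = "\<lambda>(xs, ss). map2 (*) xs ss :: real list"
  have "bij_betw ?f (signed_arrangements A) (permutations_of_set A \<times> ?S)"
  proof (rule bij_betw_byWitness[where f' = ?g])
    show "\<forall>ys\<in>signed_arrangements A. ?g (?f ys) = ys"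
      by (simp add: list_eq_iff_nth_eq abs_mult_sgn)
    show "\<forall>p\<in>permutations_of_set A \<times> ?S. ?f (?g p) = p"
    proof
      fix p assume "p \<in> permutations_of_set A \<times> ?S"
      then obtain xs ss
          where p: "p = (xs, ss)" "set xs = A" "distinct xs" "set ss \<subseteq> {1, -1}" "length ss = card A"
        by (auto simp: permutations_of_set_def)
      have len: "length xs = length ss" using p distinct_card by metis
      have "\<bar>xs ! i * ss ! i\<bar> = xs ! i" "sgn (xs ! i * ss ! i) = ss ! i"
          if "i < length ss" for i
      proof -
        have "0 < xs ! i" "ss ! i = 1 \<or> ss ! i = -1"
          using subsetD[OF p(4) nth_mem[of i ss]] subsetD[OF assms(2), of "xs ! i"] nth_mem[of i xs]
            p(2) len that by auto
        then show "\<bar>xs ! i * ss ! i\<bar> = xs ! i" "sgn (xs ! i * ss ! i) = ss ! i" by auto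
      qed
      then show "?f (?g p) = p" unfolding p(1) using len by (simp add: list_eq_iff_nth_eq)
    qed
    show "?f ` signed_arrangements A \<subseteq> permutations_of_set A \<times> ?S"
    proof
      fix p assume "p \<in> ?f ` signed_arrangements A"
      then obtain ys where p: "p = ?f ys" and ys: "distinct (map abs ys)" "set (map abs ys) = A"
        unfolding signed_arrangements_def by blast
      have "length ys = card A" using distinct_card[OF ys(1)] ys(2) by simp
      moreover have "y \<noteq> 0" if "y \<in> set ys" for y using ys(2) assms(2) that by force
      then have "sgn ` set ys \<subseteq> {1, -1}" by (auto simp: sgn_if)
      ultimately show "p \<in> permutations_of_set A \<times> ?S"
        unfolding p using ys by (simp add: permutations_of_set_def)
    qed
    show "?g ` (permutations_of_set A \<times> ?S) \<subseteq> signed_arrangements A"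
    proof
      fix ys assume "ys \<in> ?g ` (permutations_of_set A \<times> ?S)"
      then obtain xs ss
          where p: "ys = map2 (*) xs ss" "set xs = A" "distinct xs" "set ss \<subseteq> {1, -1}" "length ss = card A"
        by (auto simp: permutations_of_set_def)
      have len: "length xs = length ss" using p distinct_card by metis
      have "\<bar>xs ! i * ss ! i\<bar> = xs ! i" if "i < length ss" for i
        using subsetD[OF p(4) nth_mem[OF that]] subsetD[OF assms(2), of "xs ! i"] nth_mem[of i xs]
          p(2) len that by auto
      then have "map abs ys = xs" unfolding p(1) using len by (simp add: list_eq_iff_nth_eq)
      then show "ys \<in> signed_arrangements A"
        using p(2,3) unfolding signed_arrangements_def by (simp del: set_map)
    qed
  qed
  then have "card (signed_arrangements A) = card (permutations_of_set A \<times> ?S)"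
      by (rule bij_betw_same_card)
  also have "\<dots> = fact (card A) * 2 ^ card A"
    using card_lists_length_eq[of "{1, -1 :: real}" "card A"] assms
    by (simp add: card_cartesian_product numeral_2_eq_2)
  finally show ?thesis by simp
qed

section \<open>The cut bijection and the number of positive arrangements\<close>

lemma sum_list_take_rev:
  fixes zs :: "real list"
  assumes "j \<le> length zs"
  shows "sum_list (take j (rev zs)) = sum_list zs - sum_list (take (length zs - j) zs)"
proof -
  have "take j (rev zs) = rev (drop (length zs - j) zs)" by (simp add: take_rev)
  moreover have "sum_list zs = sum_list (take (length zs - j) zs) + sum_list (drop (length zs - j) zs)"
    by (metis append_take_drop_id sum_list_append)
  ultimately show ?thesis by (simp add: sum_list_rev)
qed

lemma sum_list_map_uminus: "sum_list (map uminus zs) = - sum_list (zs :: real list)"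
  by (induction zs) auto

lemma positive_prefix:
  assumes "us \<in> positive_arrangements S" "us = as @ bs" "as \<noteq> []"
  shows "0 < sum_list as"
proof -
  have "as = take (length as) us" "length as \<in> {1..length us}"
    using assms(2,3) by (auto simp: Suc_le_eq)
  then show ?thesis using assms(1) unfolding positive_arrangements_def by fastforce
qed

text \<open>If two different cuts gave the same list, the block \<open>ws\<close> between them would
  be a reversed initial piece of one first part, with positive sum, and a negated initial piece of
  one second part, with negative sum.\<close>

lemma reflect_append_inj:
  assumes "us \<in> positive_arrangements S" "vs \<in> positive_arrangements T"
    "us' \<in> positive_arrangements S'" "vs' \<in> positive_arrangements T'"
    and eq: "rev us @ map uminus vs = rev us' @ map uminus vs'"
  shows "us = us' \<and> vs = vs'"
proof -
  have *: "us = us'"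
    if "us' \<in> positive_arrangements S'" "vs \<in> positive_arrangements T"
      "rev us' = rev us @ ws" "map uminus vs = ws @ map uminus vs'" for us us' vs vs' ws S' T
  proof (rule ccontr)
    assume "us \<noteq> us'"
    then have ne: "ws \<noteq> []" using that(3) by auto
    have "us' = rev ws @ us" using arg_cong[OF that(3), of rev] by simp
    then have "0 < sum_list ws"
      using positive_prefix[OF that(1)] ne by (metis sum_list_rev rev_is_Nil_conv)
    moreover have "vs = map uminus ws @ vs'"
      using arg_cong[OF that(4), of "map uminus"] by (simp add: comp_def)
    then have "0 < sum_list (map uminus ws)"
      using positive_prefix[OF that(2)] ne by (metis map_is_Nil_conv)
    ultimately show False by (simp add: sum_list_map_uminus)
  qed
  obtain ws where "rev us' = rev us @ ws \<and> map uminus vs = ws @ map uminus vs' \<or>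
      rev us = rev us' @ ws \<and> map uminus vs' = ws @ map uminus vs"
    using eq unfolding append_eq_append_conv2 by metis
  then have "us = us'" using * assms by metis
  moreover have "vs = vs'"
    using eq \<open>us = us'\<close> by (simp add: inj_map_eq_map)
  ultimately show ?thesis by simp
qed

text \<open>Cut at the position where the prefix sums are maximal.\<close>

lemma reflect_append_surj:
  assumes gen: "generic_weights A" and zs: "zs \<in> signed_arrangements A"
  shows "\<exists>S us vs. S \<subseteq> A \<and> us \<in> positive_arrangements S \<and> vs \<in> positive_arrangements (A - S) \<and>
    zs = rev us @ map uminus vs"
proof -
  have d: "distinct (map abs zs)" and A: "set (map abs zs) = A"
    using zs unfolding signed_arrangements_def by auto
  define s where "s k = sum_list (take k zs)" for k
  obtain k where k: "k \<le> length zs" "\<And>j. j \<le> length zs \<Longrightarrow> s j \<le> s k"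
  proof -
    have "Max (s ` {..length zs}) \<in> s ` {..length zs}" by (intro Max_in) auto
    then obtain k where "k \<le> length zs" "Max (s ` {..length zs}) = s k"
      by (metis imageE atMost_iff)
    then show thesis using that[of k] by (metis Max_ge atMost_iff finite_atMost finite_imageI image_eqI)
  qed
  define as bs where "as = take k zs" and "bs = drop k zs"
  have zs_eq: "zs = as @ bs" unfolding as_def bs_def by simp
  have len: "length as = k" unfolding as_def using k by simp
  \<comment> \<open>No nonempty block of consecutive entries sums to 0, so the maximum is attained
    only once; this makes the inequalities strict on both sides of the cut.\<close>
  have nz: "sum_list ws \<noteq> 0" if "zs = ps @ ws @ qs" "ws \<noteq> []" for ps ws qs
    using generic_weights_sum_list[OF gen _ _ that(2)] d A unfolding that(1) by auto
  let ?S = "set (map abs as)"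
  have "rev as \<in> positive_arrangements ?S"
    unfolding positive_arrangements_def
  proof (intro CollectI conjI ballI)
    show "rev as \<in> signed_arrangements ?S"
      using d unfolding signed_arrangements_def zs_eq by (auto simp: rev_map[symmetric])
    fix j assume "j \<in> {1..length (rev as)}"
    then have j: "1 \<le> j" "j \<le> k" using len by auto
    have eq: "sum_list (take j (rev as)) = s k - s (k - j)"
      using sum_list_take_rev[of j as] j len k unfolding s_def as_def by (simp add: min_def)
    have "zs = take (k - j) zs @ drop (k - j) as @ bs"
      unfolding zs_eq using len by simp
    moreover have "drop (k - j) as \<noteq> []" using j len by simp
    ultimately have "sum_list (drop (k - j) as) \<noteq> 0" using nz by blast
    moreover have "take j (rev as) = rev (drop (k - j) as)" using len by (simp add: take_rev)
    ultimately have "sum_list (take j (rev as)) \<noteq> 0" by (simp add: sum_list_rev)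
    moreover have "s (k - j) \<le> s k" using k by simp
    ultimately show "0 < sum_list (take j (rev as))" unfolding eq by simp
  qed
  moreover have "map uminus bs \<in> positive_arrangements (A - ?S)"
    unfolding positive_arrangements_def
  proof (intro CollectI conjI ballI)
    show "map uminus bs \<in> signed_arrangements (A - ?S)"
    proof -
      have eq: "map abs (map uminus bs) = map abs bs" by (simp add: comp_def)
      have "distinct (map abs bs)" "?S \<inter> set (map abs bs) = {}" "A = ?S \<union> set (map abs bs)"
        using d A unfolding zs_eq map_append distinct_append set_append by blast+
      then have "distinct (map abs bs)" "set (map abs bs) = A - ?S" by blast+
      then show ?thesis unfolding signed_arrangements_def mem_Collect_eq eq by (rule conjI)
    qed
    fix j assume "j \<in> {1..length (map uminus bs)}"
    then have j: "1 \<le> j" "j \<le> length bs" by auto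
    have "s (k + j) = s k + sum_list (take j bs)"
      unfolding s_def bs_def by (simp add: take_add)
    moreover have "s (k + j) \<le> s k" using k(2) j unfolding bs_def by simp
    moreover have "zs = as @ take j bs @ drop j bs" unfolding zs_eq by simp
    moreover have "take j bs \<noteq> []" using j by auto
    ultimately have "sum_list (take j bs) < 0" using nz[of as "take j bs" "drop j bs"] by fastforce
    then show "0 < sum_list (take j (map uminus bs))"
      by (simp add: take_map sum_list_map_uminus)
  qed
  moreover have "?S \<subseteq> A" using A unfolding zs_eq by auto
  moreover have "zs = rev (rev as) @ map uminus (map uminus bs)"
    unfolding zs_eq by (simp add: comp_def)
  ultimately show ?thesis by blast
qed

lemma finite_positive_arrangements: "finite A \<Longrightarrow> finite (positive_arrangements A)"
proof (rule finite_subset)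
  assume A: "finite A"
  show "positive_arrangements A \<subseteq> {ys. set ys \<subseteq> A \<union> uminus ` A \<and> length ys \<le> card A}"
  proof
    fix ys assume "ys \<in> positive_arrangements A"
    then have ys: "distinct (map abs ys)" "set (map abs ys) = A"
      unfolding positive_arrangements_def signed_arrangements_def by auto
    have "length ys \<le> card A" using distinct_card[OF ys(1)] ys(2) by simp
    moreover have "y \<in> A \<union> uminus ` A" if "y \<in> set ys" for y
    proof -
      have "\<bar>y\<bar> \<in> A" using ys(2) that by auto
      then show ?thesis by (cases "0 \<le> y") (auto simp: image_iff intro!: bexI[of _ "- y"])
    qed
    ultimately show "ys \<in> {ys. set ys \<subseteq> A \<union> uminus ` A \<and> length ys \<le> card A}" by blast
  qed
  show "finite {ys. set ys \<subseteq> A \<union> uminus ` A \<and> length ys \<le> card A}"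
    using A by (intro finite_lists_length_le) auto
qed

lemma signed_arrangements_split:
  assumes gen: "generic_weights A"
  shows "card (signed_arrangements A) =
    (\<Sum>S\<in>Pow A. card (positive_arrangements S) * card (positive_arrangements (A - S)))"
proof -
  let ?D = "SIGMA S:Pow A. positive_arrangements S \<times> positive_arrangements (A - S)"
  let ?f = "\<lambda>(S :: real set, us, vs). rev us @ map uminus vs :: real list"
  have finA: "finite A" using gen unfolding generic_weights_def by auto
  have supp: "set (map abs us) = S" "distinct (map abs us)" if "us \<in> positive_arrangements S"
      for us S
    using that unfolding positive_arrangements_def signed_arrangements_def by auto
  have "bij_betw ?f ?D (signed_arrangements A)"
    unfolding bij_betw_def
  proof
    show "inj_on ?f ?D"
    proof (rule inj_onI)
      fix p q assume pq: "p \<in> ?D" "q \<in> ?D" "?f p = ?f q"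
      obtain S us vs where p: "p = (S, us, vs)" by (cases p)
      obtain T us' vs' where q: "q = (T, us', vs')" by (cases q)
      have "us = us' \<and> vs = vs'"
        using pq unfolding p q by (intro reflect_append_inj[of us S vs "A - S" us' T vs' "A - T"]) auto
      moreover have "set (map abs us) = S" "set (map abs us') = T"
        using pq supp(1) unfolding p q by blast+
      ultimately show "p = q" unfolding p q by auto
    qed
    show "?f ` ?D = signed_arrangements A"
    proof (intro equalityI subsetI)
      fix zs assume "zs \<in> ?f ` ?D"
      then obtain S us vs where "S \<subseteq> A" and u: "us \<in> positive_arrangements S"
        and v: "vs \<in> positive_arrangements (A - S)" and z: "zs = rev us @ map uminus vs" by auto
      have m: "map abs zs = rev (map abs us) @ map abs vs" unfolding z by (simp add: rev_map comp_def)
      have "set (map abs zs) = S \<union> (A - S)"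
        unfolding m using supp(1)[OF u] supp(1)[OF v] by simp
      moreover have "distinct (map abs zs)"
        unfolding m distinct_append using supp[OF u] supp[OF v] by auto
      ultimately show "zs \<in> signed_arrangements A"
        using \<open>S \<subseteq> A\<close> unfolding signed_arrangements_def by auto
    next
      fix zs assume "zs \<in> signed_arrangements A"
      then obtain S us vs where "S \<subseteq> A" "us \<in> positive_arrangements S"
        "vs \<in> positive_arrangements (A - S)" "zs = rev us @ map uminus vs"
        using reflect_append_surj[OF gen] by blast
      then show "zs \<in> ?f ` ?D" by (intro image_eqI[of _ _ "(S, us, vs)"]) auto
    qed
  qed
  then have "card (signed_arrangements A) = card ?D" by (rule bij_betw_same_card[symmetric])
  also have "\<dots> = (\<Sum>S\<in>Pow A. card (positive_arrangements S \<times> positive_arrangements (A - S)))"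
    using finA
    by (intro card_SigmaI ballI finite_cartesian_product finite_positive_arrangements finite_Pow_iff[THEN iffD2])
      (auto intro: finite_subset)
  finally show ?thesis by (simp add: card_cartesian_product)
qed

text \<open>The number of positive arrangements is $(2n-1)!!$; this form makes the convolution identity
  an instance of Vandermonde's.\<close>

definition arrangement_count :: "nat \<Rightarrow> real" where
  "arrangement_count n = (- 2) ^ n * fact n * ((- 1 / 2) gchoose n)"

text \<open>In exponential generating functions: the counts belong to (1 - 2x)^(-1/2), and its
  square 1/(1 - 2x) belongs to 2^n n!, the number of all signed arrangements.\<close>

lemma arrangement_count_convolution:
  "(\<Sum>k\<le>n. real (n choose k) * (arrangement_count k * arrangement_count (n - k))) = 2 ^ n * fact n"
proof -
  have "real (n choose k) * (arrangement_count k * arrangement_count (n - k)) =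
      (- 2) ^ n * fact n * (((- 1 / 2) gchoose k) * ((- 1 / 2) gchoose (n - k)))" if "k \<le> n" for k
  proof -
    have f: "real (n choose k) * (fact k * fact (n - k)) = fact n"
      using binomial_fact[OF that, where 'a = real] by simp
    have p: "(- 2 :: real) ^ k * (- 2) ^ (n - k) = (- 2) ^ n"
      using that by (simp flip: power_add)
    have "real (n choose k) * (arrangement_count k * arrangement_count (n - k)) =
        ((- 2) ^ k * (- 2) ^ (n - k)) * (real (n choose k) * (fact k * fact (n - k))) *
        (((- 1 / 2) gchoose k) * ((- 1 / 2) gchoose (n - k)))"
      unfolding arrangement_count_def by (simp only: mult_ac)
    then show ?thesis unfolding f p .
  qed
  then have "(\<Sum>k\<le>n. real (n choose k) * (arrangement_count k * arrangement_count (n - k))) =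
      (- 2) ^ n * fact n * (\<Sum>k\<le>n. ((- 1 / 2) gchoose k) * ((- 1 / 2) gchoose (n - k)))"
    by (simp add: sum_distrib_left)
  also have "(\<Sum>k\<le>n. ((- 1 / 2) gchoose k) * ((- 1 / 2 :: real) gchoose (n - k))) = (- 1) gchoose n"
    using gbinomial_Vandermonde[where a = "- 1 / 2 :: real" and b = "- 1 / 2" and n = n]
        by (simp add: atLeast0AtMost)
  also have "(- 1 :: real) gchoose n = (- 1) ^ n"
    using gbinomial_minus[of "1 :: real" n] by (simp add: binomial_gbinomial[symmetric])
  finally show ?thesis by (simp add: power_mult_distrib[symmetric] mult.commute mult.left_commute)
qed

text \<open>Both sides satisfy the same convolution. For nonempty \<open>A\<close> the terms for the
  empty set and for \<open>A\<close> each contain the unknown value with factor 1, and all other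
  terms involve only proper subsets, so the identity can be solved for the value at
  \<open>A\<close>.\<close>

lemma card_positive_arrangements:
  "generic_weights A \<Longrightarrow> real (card (positive_arrangements A)) = arrangement_count (card A)"
proof (induction "card A" arbitrary: A rule: less_induct)
  case less
  have A: "finite A" "A \<subseteq> {0<..}" using less.prems unfolding generic_weights_def by auto
  let ?c = "\<lambda>S. real (card (positive_arrangements S))" and ?a = arrangement_count
  have c0: "?c {} = 1"
  proof -
    have "positive_arrangements {} = {[]}"
      unfolding positive_arrangements_def signed_arrangements_def by auto
    then show ?thesis by simp
  qed
  have a0: "?a 0 = 1" unfolding arrangement_count_def by simp
  show ?case
  proof (cases "A = {}")
    case True
    then show ?thesis using c0 a0 by simp
  next
    case False
    let ?I = "Pow A - {{}, A}"
    have split: "(\<Sum>S\<in>Pow A. h S) = h {} + h A + (\<Sum>S\<in>?I. h S)"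
        for h :: "real set \<Rightarrow> real"
    proof -
      have "Pow A = insert {} (insert A ?I)" by auto
      then have "(\<Sum>S\<in>Pow A. h S) = (\<Sum>S\<in>insert {} (insert A ?I). h S)" by simp
      then show ?thesis using A False by simp
    qed
    have "(\<Sum>S\<in>Pow A. ?a (card S) * ?a (card (A - S))) =
        (\<Sum>S\<in>Pow A. ?a (card S) * ?a (card A - card S))"
      using A by (intro sum.cong) (auto simp: card_Diff_subset finite_subset)
    also have "\<dots> = (\<Sum>k\<le>card A. \<Sum>S | S \<in> Pow A \<and> card S = k. ?a (card S) * ?a (card A - card S))"
      using A by (intro sum.group[symmetric]) (auto intro: card_mono)
    also have "\<dots> = (\<Sum>k\<le>card A. real (card A choose k) * (?a k * ?a (card A - k)))"
    proof (intro sum.cong refl)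
      fix k
      have "(\<Sum>S | S \<in> Pow A \<and> card S = k. ?a (card S) * ?a (card A - card S)) =
          (\<Sum>S | S \<in> Pow A \<and> card S = k. ?a k * ?a (card A - k))" by (intro sum.cong) auto
      then show "(\<Sum>S | S \<in> Pow A \<and> card S = k. ?a (card S) * ?a (card A - card S)) =
          real (card A choose k) * (?a k * ?a (card A - k))"
        using n_subsets[OF A(1), of k] by simp
    qed
    also have "\<dots> = real (card (signed_arrangements A))"
      unfolding arrangement_count_convolution using card_signed_arrangements[OF A] by simp
    also have "\<dots> = (\<Sum>S\<in>Pow A. ?c S * ?c (A - S))"
      unfolding signed_arrangements_split[OF less.prems] by simp
    finally have "(\<Sum>S\<in>Pow A. ?a (card S) * ?a (card (A - S))) = (\<Sum>S\<in>Pow A. ?c S * ?c (A - S))" .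
    moreover have "(\<Sum>S\<in>?I. ?a (card S) * ?a (card (A - S))) = (\<Sum>S\<in>?I. ?c S * ?c (A - S))"
    proof (intro sum.cong refl)
      fix S assume S: "S \<in> ?I"
      then have "S \<subset> A" "A - S \<subset> A" by auto
      then have "?c S = ?a (card S)" "?c (A - S) = ?a (card (A - S))"
        using A less.hyps generic_weights_subset[OF less.prems] psubset_card_mono
            by (metis psubset_imp_subset)+
      then show "?a (card S) * ?a (card (A - S)) = ?c S * ?c (A - S)" by simp
    qed
    ultimately have "2 * ?a (card A) = 2 * ?c A" unfolding split using c0 a0 by simp
    then show ?thesis by simp
  qed
qed

text \<open>Here \<open>2 ^ n * fact n\<close> counts all signed arrangements, and the remaining
  factor is Sparre Andersen's probability of staying positive.\<close>

lemma arrangement_count_eq: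
  "arrangement_count n = 2 ^ n * fact n * real ((2 * n) choose n) / 4 ^ n"
proof -
  have cb: "real ((2 * k) choose k) = fact (2 * k) / (fact k * fact k)" for k
  proof -
    have "2 * k - k = k" by simp
    then show ?thesis using binomial_fact[of k "2 * k", where 'a = real] by simp
  qed
  have "((- 1 / 2 :: real) gchoose n) = (- 1) ^ n * (fact (2 * n) / (fact n * fact n)) / 4 ^ n"
  proof (induction n)
    case (Suc n)
    have g: "((- 1 / 2 :: real) gchoose Suc n) = ((- 1 / 2) gchoose n) * (- 1 / 2 - real n) / real (Suc n)"
      by (simp add: gbinomial_prod_rev field_simps)
    have "2 * Suc n = Suc (Suc (2 * n))" by simp
    then have f: "fact (2 * Suc n) = (2 * real n + 2) * (2 * real n + 1) * fact (2 * n)"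
      by (simp only: fact_Suc) (simp add: algebra_simps)
    have "((- 1 / 2 :: real) gchoose Suc n) =
        (- 1) ^ n * (fact (2 * n) / (fact n * fact n)) / 4 ^ n * (- 1 / 2 - real n) / real (Suc n)"
      unfolding g Suc.IH ..
    also have "\<dots> = (- 1) ^ Suc n * (fact (2 * Suc n) / (fact (Suc n) * fact (Suc n))) / 4 ^ Suc n"
      unfolding f fact_Suc by (simp add: divide_simps) (simp add: algebra_simps)
    finally show ?case .
  qed simp
  moreover have "(- 2 :: real) ^ n * (- 1) ^ n = 2 ^ n" by (simp flip: power_mult_distrib)
  ultimately show ?thesis unfolding arrangement_count_def cb
    by (simp add: mult_ac)
qed

section \<open>The volume\<close>

text \<open>The bridge from prefix sums over an ordered index type to the list combinatorics of
  arrangements.\<close>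

definition coordinate_list :: "real^'n::{finite,linorder} \<Rightarrow> real list" where
  "coordinate_list x = map (($) x) (sorted_list_of_set UNIV)"

lemma length_coordinate_list [simp]: "length (coordinate_list (x :: real^'n::{finite,linorder})) = CARD('n)"
  unfolding coordinate_list_def by simp

lemma dominant_iff_coordinate_list:
  fixes x :: "real^'n::{finite,linorder}"
  shows "dominant x \<longleftrightarrow> (\<forall>k\<in>{1..CARD('n)}. 0 \<le> sum_list (take k (coordinate_list x)))"
proof -
  define L where "L = sorted_list_of_set (UNIV :: 'n set)"
  have L: "distinct L" "set L = UNIV" "length L = CARD('n)" "sorted L"
    unfolding L_def by simp_all
  have take_set: "set (take (Suc k) L) = {..L ! k}" if k: "k < CARD('n)" for k
  proof (intro equalityI subsetI)
    fix v assume "v \<in> set (take (Suc k) L)"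
    then obtain j where "j \<le> k" "v = L ! j" using k L(3)
        by (auto simp: in_set_conv_nth less_Suc_eq_le)
    then show "v \<in> {..L ! k}" using sorted_nth_mono[OF L(4)] k L(3) by simp
  next
    fix v assume v: "v \<in> {..L ! k}"
    obtain j where j: "j < CARD('n)" "v = L ! j" using L(2,3) by (metis UNIV_I in_set_conv_nth)
    have "j \<le> k"
    proof (rule ccontr)
      assume "\<not> j \<le> k"
      then have "L ! k \<le> L ! j" using sorted_nth_mono[OF L(4), of k j] j L(3) by simp
      then have "L ! k = L ! j" using v j by simp
      then show False using nth_eq_iff_index_eq[OF L(1), of k j] k j L(3) \<open>\<not> j \<le> k\<close> by simp
    qed
    then show "v \<in> set (take (Suc k) L)"
      using j k L(3) by (auto simp: in_set_conv_nth intro!: exI[of _ j])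
  qed
  have sum: "sum_list (take (Suc k) (coordinate_list x)) = (\<Sum>i\<in>{..L ! k}. x $ i)"
      if "k < CARD('n)" for k
    unfolding coordinate_list_def L_def[symmetric] take_map take_set[OF that, symmetric]
    using L(1) by (simp add: sum_list_distinct_conv_sum_set)
  show ?thesis
  proof
    assume dom: "dominant x"
    show "\<forall>k\<in>{1..CARD('n)}. 0 \<le> sum_list (take k (coordinate_list x))"
    proof
      fix k assume "k \<in> {1..CARD('n)}"
      then obtain m where "k = Suc m" "m < CARD('n)" by (cases k) auto
      then show "0 \<le> sum_list (take k (coordinate_list x))"
        using sum dom unfolding dominant_def by simp
    qed
  next
    assume r: "\<forall>k\<in>{1..CARD('n)}. 0 \<le> sum_list (take k (coordinate_list x))"
    show "dominant x" unfolding dominant_def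
    proof
      fix v
      obtain j where j: "j < CARD('n)" "v = L ! j" using L(2,3) by (metis UNIV_I in_set_conv_nth)
      then show "0 \<le> (\<Sum>i\<in>{..v}. x $ i)" using r sum[OF j(1)]
          by (metis Suc_le_eq atLeastAtMost_iff le_add1 plus_1_eq_Suc)
    qed
  qed
qed

section \<open>The hyperoctahedral group as a family of isometries\<close>

definition signed_permutations :: "(('n::finite \<Rightarrow> 'n) \<times> ('n \<Rightarrow> real)) set" where
  "signed_permutations = {\<pi>. \<pi> permutes UNIV} \<times> {\<epsilon>. \<forall>i. \<epsilon> i \<in> {1, -1}}"

fun signed_permute :: "('n \<Rightarrow> 'n) \<times> ('n \<Rightarrow> real) \<Rightarrow> real^'n \<Rightarrow> real^'n::finite" where
  "signed_permute (\<pi>, \<epsilon>) x = (\<chi> i. \<epsilon> i * x $ \<pi> i)"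

lemma finite_signed_permutations: "finite (signed_permutations :: (('n::finite \<Rightarrow> 'n) \<times> _) set)"
proof -
  have "{\<epsilon> :: 'n \<Rightarrow> real. \<forall>i. \<epsilon> i \<in> {1, -1}} = PiE UNIV (\<lambda>_. {1, -1})" by (auto simp: PiE_def)
  then show ?thesis unfolding signed_permutations_def by (simp add: finite_PiE finite_permutations)
qed

lemma signed_permutationsE:
  assumes "g \<in> signed_permutations"
  obtains \<pi> \<epsilon>
      where "g = (\<pi>, \<epsilon>)" "\<pi> permutes UNIV" "bij \<pi>" "\<And>i. \<epsilon> i = 1 \<or> \<epsilon> i = -1"
  using assms permutes_imp_bij unfolding signed_permutations_def by blast

lemma orthogonal_signed_permute:
  assumes "g \<in> signed_permutations"
  shows "orthogonal_transformation (signed_permute g)"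
proof -
  obtain \<pi> \<epsilon> where g: "g = (\<pi>, \<epsilon>)" and \<pi>: "bij \<pi>"
      and \<epsilon>': "\<And>i. \<epsilon> i = 1 \<or> \<epsilon> i = -1"
    using assms by (elim signed_permutationsE) blast
  have \<epsilon>: "\<epsilon> i * \<epsilon> i = 1" for i using \<epsilon>'[of i] by auto
  have "linear (signed_permute g)"
    unfolding g by (intro linearI) (auto simp: vec_eq_iff algebra_simps)
  moreover have "signed_permute g v \<bullet> signed_permute g w = v \<bullet> w" for v w
  proof -
    have "signed_permute g v \<bullet> signed_permute g w = (\<Sum>i\<in>UNIV. (\<epsilon> i * \<epsilon> i) * (v $ \<pi> i * w $ \<pi> i))"
      unfolding g inner_vec_def by (simp add: mult_ac)
    also have "\<dots> = (\<Sum>i\<in>UNIV. v $ \<pi> i * w $ \<pi> i)" by (simp add: \<epsilon>)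
    also have "\<dots> = v \<bullet> w"
      unfolding inner_vec_def using sum.reindex_bij_betw[OF \<pi>, of "\<lambda>i. v $ i * w $ i"]
          by simp
    finally show ?thesis .
  qed
  ultimately show ?thesis unfolding orthogonal_transformation_def by blast
qed

lemma signed_permute_l1:
  assumes "g \<in> signed_permutations"
  shows "(\<Sum>i\<in>UNIV. \<bar>signed_permute g x $ i\<bar>) = (\<Sum>i\<in>UNIV. \<bar>x $ i\<bar>)"
proof -
  obtain \<pi> \<epsilon> where g: "g = (\<pi>, \<epsilon>)" and \<pi>: "bij \<pi>"
      and \<epsilon>': "\<And>i. \<epsilon> i = 1 \<or> \<epsilon> i = -1"
    using assms by (elim signed_permutationsE) blast
  have \<epsilon>: "\<bar>\<epsilon> i\<bar> = 1" for i using \<epsilon>'[of i] by auto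
  show ?thesis
    unfolding g using sum.reindex_bij_betw[OF \<pi>, of "\<lambda>i. \<bar>x $ i\<bar>"]
        by (simp add: abs_mult \<epsilon>)
qed

lemma generic_nth_inj:
  assumes "generic x"
  shows "x $ i \<noteq> 0" "i \<noteq> j \<Longrightarrow> x $ i \<noteq> x $ j"
proof -
  have *: "(\<Sum>i\<in>UNIV. \<delta> i * x $ i) \<noteq> 0"
      if "\<And>i. \<delta> i \<in> {-1, 0, 1}" "\<delta> i \<noteq> 0" for \<delta> i
    using assms that unfolding generic_def by blast
  show "x $ i \<noteq> 0" using *[of "\<lambda>k. if k = i then 1 else 0" i]
    by (simp add: if_distrib[of "\<lambda>a. a * _"] cong: if_cong)
  assume ij: "i \<noteq> j"
  have "(\<Sum>k\<in>UNIV. (if k = i then 1 else if k = j then -1 else 0) * x $ k) =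
      (\<Sum>k\<in>UNIV. (if k = i then x $ k else 0) - (if k = j then x $ k else 0))"
    using ij by (intro sum.cong) auto
  also have "\<dots> = x $ i - x $ j" by (simp add: sum_subtractf)
  finally show "x $ i \<noteq> x $ j"
    using *[of "\<lambda>k. if k = i then 1 else if k = j then -1 else 0" i] by auto
qed

lemma generic_weights_range:
  assumes gen: "generic x" and pos: "\<And>i. 0 < x $ i"
  shows "generic_weights (range (($) x))"
  unfolding generic_weights_def
proof (intro conjI allI impI)
  show "range (($) x) \<subseteq> {0<..}" using pos by auto
  fix s :: "real \<Rightarrow> real" assume s: "(\<forall>a\<in>range (($) x). s a \<in> {-1, 0, 1}) \<and> (\<exists>a\<in>range (($) x). s a \<noteq> 0)"
  have "inj (($) x)" using generic_nth_inj(2)[OF gen] by (meson injI)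
  then have "(\<Sum>a\<in>range (($) x). s a * a) = (\<Sum>i\<in>UNIV. s (x $ i) * x $ i)"
    by (simp add: sum.reindex)
  also have "\<dots> \<noteq> 0" using gen s unfolding generic_def by auto
  finally show "(\<Sum>a\<in>range (($) x). s a * a) \<noteq> 0" .
qed simp

text \<open>For positive \<open>x\<close>, reading off coordinates matches signed permutations with
  signed arrangements of the coordinate set. Genericity rules out vanishing prefix sums, so the
  closed condition \<open>dominant\<close> agrees with strict positivity.\<close>

lemma card_dominant_signed_permutations:
  fixes x :: "real^'n::{finite,linorder}"
  assumes gen: "generic x" and pos: "\<And>i. 0 < x $ i"
  shows "real (card {g \<in> signed_permutations. dominant (signed_permute g x)}) = arrangement_count CARD('n)"
proof -
  let ?A = "range (($) x)" and ?f = "\<lambda>g. coordinate_list (signed_permute g x)"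
  define L where "L = sorted_list_of_set (UNIV :: 'n set)"
  have L: "distinct L" "set L = UNIV" "length L = CARD('n)" unfolding L_def by simp_all
  have inj: "inj (($) x)" using generic_nth_inj(2)[OF gen] by (meson injI)
  have cardA: "card ?A = CARD('n)" using card_image[OF inj] by simp
  have gw: "generic_weights ?A" using gen pos by (rule generic_weights_range)
  have abs: "\<bar>\<epsilon> i * x $ \<pi> i\<bar> = x $ \<pi> i"
      if "(\<pi>, \<epsilon>) \<in> signed_permutations" for \<pi> \<epsilon> i
  proof -
    have "\<epsilon> i = 1 \<or> \<epsilon> i = -1" using that unfolding signed_permutations_def
        by blast
    then show ?thesis using pos[of "\<pi> i"] by auto
  qed
  have arr: "?f g \<in> signed_arrangements ?A" if g: "g \<in> signed_permutations" for g
  proof -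
    obtain \<pi> \<epsilon> where ge: "g = (\<pi>, \<epsilon>)" by (cases g)
    have \<pi>: "\<pi> permutes UNIV" using g unfolding ge signed_permutations_def by simp
    have m: "map abs (?f g) = map (\<lambda>i. x $ \<pi> i) L"
      unfolding coordinate_list_def L_def[symmetric] ge using abs g ge by simp
    have "inj (\<lambda>i. x $ \<pi> i)" using inj permutes_inj[OF \<pi>] by (auto simp: inj_def)
    moreover have "range (\<lambda>i. x $ \<pi> i) = ?A" using permutes_surj[OF \<pi>]
        by (metis image_image)
    ultimately show ?thesis unfolding signed_arrangements_def mem_Collect_eq m
      using L(1,2) by (auto simp: distinct_map inj_on_def)
  qed
  have dom: "dominant (signed_permute g x) \<longleftrightarrow> ?f g \<in> positive_arrangements ?A"
    if g: "g \<in> signed_permutations" for g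
  proof -
    have a: "distinct (map abs (?f g))" "set (map abs (?f g)) = ?A"
      using arr[OF g] unfolding signed_arrangements_def by auto
    have nz: "sum_list (take k (?f g)) \<noteq> 0" if "k \<in> {1..CARD('n)}" for k
    proof (rule generic_weights_sum_list[OF gw])
      show "distinct (map abs (take k (?f g)))" using a(1) distinct_take[of "map abs (?f g)" k]
          by (simp add: take_map)
      show "set (map abs (take k (?f g))) \<subseteq> ?A"
          using a(2) set_take_subset[of k "map abs (?f g)"] by (simp only: take_map)
      have "length (take k (?f g)) = k" using that by simp
      then show "take k (?f g) \<noteq> []" using that
          by (metis atLeastAtMost_iff list.size(3) not_one_le_zero)
    qed
    show ?thesis
      unfolding dominant_iff_coordinate_list positive_arrangements_def
      using arr[OF g] nz by (auto simp: order_le_less)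
  qed
  have "bij_betw ?f {g \<in> signed_permutations. dominant (signed_permute g x)} (positive_arrangements ?A)"
    unfolding bij_betw_def
  proof
    show "inj_on ?f {g \<in> signed_permutations. dominant (signed_permute g x)}"
    proof (rule inj_onI)
      fix g h assume "g \<in> {g \<in> signed_permutations. dominant (signed_permute g x)}"
        "h \<in> {g \<in> signed_permutations. dominant (signed_permute g x)}" and eq: "?f g = ?f h"
      then have gh: "g \<in> signed_permutations" "h \<in> signed_permutations" by auto
      obtain \<pi> \<epsilon> where g: "g = (\<pi>, \<epsilon>)" by (cases g)
      obtain \<pi>' \<epsilon>' where h: "h = (\<pi>', \<epsilon>')" by (cases h)
      have e: "\<epsilon> i * x $ \<pi> i = \<epsilon>' i * x $ \<pi>' i" for i
        using eq L(2) unfolding coordinate_list_def L_def[symmetric] g h by simp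
      have p: "\<pi> i = \<pi>' i" for i
        using arg_cong[OF e[of i], of abs] abs gh g h inj by (metis injD)
      have "\<epsilon> i = \<epsilon>' i" for i
        using e[of i] p[of i] pos[of "\<pi>' i"] by simp
      then show "g = h" using p unfolding g h by auto
    qed
    show "?f ` {g \<in> signed_permutations. dominant (signed_permute g x)} = positive_arrangements ?A"
    proof (intro equalityI subsetI)
      fix ys assume "ys \<in> ?f ` {g \<in> signed_permutations. dominant (signed_permute g x)}"
      then show "ys \<in> positive_arrangements ?A" using dom by auto
    next
      fix ys assume ys: "ys \<in> positive_arrangements ?A"
      then have d: "distinct (map abs ys)" "set (map abs ys) = ?A"
        unfolding positive_arrangements_def signed_arrangements_def by auto
      have len: "length ys = length L" using distinct_card[OF d(1)] d(2) cardA L(3) by simp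
      \<comment> \<open>The position of \<open>i\<close> in the sorted index list.\<close>
      define h where "h i = the_inv_into {..<CARD('n)} ((!) L) i" for i
      have bij: "bij_betw ((!) L) {..<CARD('n)} UNIV"
        using bij_betw_nth[OF L(1), of "{..<CARD('n)}" UNIV] L(2,3) by simp
      have h: "h i < CARD('n)" "L ! h i = i" for i
        using f_the_inv_into_f_bij_betw[OF bij, of i] bij_betw_the_inv_into[OF bij]
        unfolding h_def by (auto dest: bij_betwE)
      have hL: "h (L ! k) = k" if "k < CARD('n)" for k
        unfolding h_def using that bij by (intro the_inv_into_f_f) (auto simp: bij_betw_def)
      have "\<bar>ys ! h i\<bar> \<in> ?A" for i
        using d(2) nth_mem[of "h i" ys] h(1)[of i] len L(3) by auto
      then have "\<exists>j. \<bar>ys ! h i\<bar> = x $ j" for i by blast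
      then obtain \<pi> where \<pi>: "\<And>i. \<bar>ys ! h i\<bar> = x $ \<pi> i" by metis
      define \<epsilon> where "\<epsilon> i = sgn (ys ! h i)" for i
      have nz: "ys ! h i \<noteq> 0" for i using \<pi>[of i] pos[of "\<pi> i"] by auto
      have "inj \<pi>"
      proof (rule injI)
        fix i j assume "\<pi> i = \<pi> j"
        then have "map abs ys ! h i = map abs ys ! h j" using \<pi> h(1) len L(3) by simp
        then have "h i = h j"
          using nth_eq_iff_index_eq[OF d(1), of "h i" "h j"] h(1) len L(3) by simp
        then show "i = j" using h(2) by metis
      qed
      then have "\<pi> permutes UNIV"
        by (intro bij_imp_permutes) (auto simp: bij_def finite_UNIV_inj_surj)
      moreover have "\<epsilon> i \<in> {1, -1}" for i using nz[of i] unfolding \<epsilon>_def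
          by (simp add: sgn_if)
      ultimately have g: "(\<pi>, \<epsilon>) \<in> signed_permutations"
          unfolding signed_permutations_def by simp
      have "?f (\<pi>, \<epsilon>) = ys"
      proof (rule nth_equalityI)
        show "length (?f (\<pi>, \<epsilon>)) = length ys" using len L(3) by simp
        fix k assume "k < length (?f (\<pi>, \<epsilon>))"
        then have k: "k < CARD('n)" by simp
        have "\<epsilon> (L ! k) * x $ \<pi> (L ! k) = sgn (ys ! k) * \<bar>ys ! k\<bar>"
          unfolding \<epsilon>_def \<pi>[symmetric] hL[OF k] ..
        then show "?f (\<pi>, \<epsilon>) ! k = ys ! k"
          using k L(3) unfolding coordinate_list_def L_def[symmetric] by (simp add: sgn_mult_abs)
      qed
      then show "ys \<in> ?f ` {g \<in> signed_permutations. dominant (signed_permute g x)}"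
        using g dom[OF g] ys by (intro image_eqI[of _ _ "(\<pi>, \<epsilon>)"]) auto
    qed
  qed
  then have "card {g \<in> signed_permutations. dominant (signed_permute g x)} = card (positive_arrangements ?A)"
    by (rule bij_betw_same_card)
  then show ?thesis using card_positive_arrangements[OF gw] cardA by simp
qed

text \<open>The signs are forced to be those of \<open>x\<close>, while every permutation works,
  with the permuted absolute values as \<open>y\<close>.\<close>

lemma card_orthant_signed_permutations:
  fixes x :: "real^'n::finite"
  assumes nz: "\<And>i. x $ i \<noteq> 0"
  shows "card {g \<in> signed_permutations. \<exists>y. (\<forall>i. 0 \<le> y $ i) \<and> x = signed_permute g y} = fact CARD('n)"
proof -
  have "{g \<in> signed_permutations. \<exists>y. (\<forall>i. 0 \<le> y $ i) \<and> x = signed_permute g y} =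
      {\<pi> :: 'n \<Rightarrow> 'n. \<pi> permutes UNIV} \<times> {\<lambda>i. sgn (x $ i)}" (is "?L = ?R")
  proof (intro equalityI subsetI)
    fix g assume "g \<in> ?L"
    then obtain y where "g \<in> signed_permutations"
        and y: "\<And>i. 0 \<le> y $ i" "x = signed_permute g y"
      by blast
    then obtain \<pi> \<epsilon>
        where g: "g = (\<pi>, \<epsilon>)" "\<pi> permutes UNIV" "\<And>i. \<epsilon> i = 1 \<or> \<epsilon> i = -1"
      by (elim signed_permutationsE) blast
    have "\<epsilon> i = sgn (x $ i)" for i
    proof -
      have "x $ i = \<epsilon> i * y $ \<pi> i" unfolding y(2) g(1) by simp
      then show ?thesis using nz[of i] y(1)[of "\<pi> i"] g(3)[of i] by (auto simp: sgn_if)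
    qed
    then show "g \<in> ?R" using g by auto
  next
    fix g assume "g \<in> ?R"
    then obtain \<pi> where g: "g = (\<pi>, \<lambda>i. sgn (x $ i))"
        and \<pi>: "\<pi> permutes UNIV" by auto
    have "g \<in> signed_permutations"
      using g \<pi> nz unfolding signed_permutations_def by (simp add: sgn_if)
    moreover have "x = signed_permute g (\<chi> j. \<bar>x $ inv \<pi> j\<bar>)"
      unfolding g using permutes_inverses(2)[OF \<pi>] by (simp add: vec_eq_iff sgn_mult_abs)
    ultimately show "g \<in> ?L"
        by (intro CollectI conjI exI[of _ "\<chi> j. \<bar>x $ inv \<pi> j\<bar>"]) auto
  qed
  then show ?thesis by (simp add: card_cartesian_product card_permutations[of UNIV "CARD('n)"])
qed

text \<open>Double counting: almost everywhere the indicator functions of the \<open>A i\<close> add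
  up to \<open>K\<close> times that of \<open>S\<close>; integrate both.\<close>

lemma sum_measure_eq_count:
  fixes A :: "'i \<Rightarrow> 'a::euclidean_space set"
  assumes "finite I"
      and A: "\<And>i. i \<in> I \<Longrightarrow> A i \<in> lmeasurable" "\<And>i. i \<in> I \<Longrightarrow> A i \<subseteq> S"
    and S: "S \<in> lmeasurable" and N: "negligible N"
    and count: "\<And>x. x \<in> S - N \<Longrightarrow> real (card {i \<in> I. x \<in> A i}) = K"
  shows "(\<Sum>i\<in>I. measure lebesgue (A i)) = K * measure lebesgue S"
proof -
  have "(\<Sum>i\<in>I. measure lebesgue (A i)) = (\<Sum>i\<in>I. integral UNIV (indicator (A i)))"
    by (intro sum.cong refl lmeasure_integral_UNIV A)
  also have "\<dots> = integral UNIV (\<lambda>x. \<Sum>i\<in>I. indicator (A i) x)"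
    using assms(1) A(1)
        by (intro integral_sum[symmetric]) (blast intro: has_integral_integrable lmeasurable_iff_has_integral[THEN iffD1])+
  also have "\<dots> = integral UNIV (\<lambda>x. K * indicator S x)"
  proof (rule integral_spike[OF N])
    fix x assume "x \<in> UNIV - N"
    then have x: "x \<notin> N" by simp
    have c: "(\<Sum>i\<in>I. indicator (A i) x) = real (card {i \<in> I. x \<in> A i})"
      using assms(1) by (simp add: indicator_def sum.If_cases Int_def)
    show "K * indicator S x = (\<Sum>i\<in>I. indicator (A i) x)"
    proof (cases "x \<in> S")
      case True
      then show ?thesis unfolding c using count x by simp
    next
      case False
      have e: "{i \<in> I. x \<in> A i} = {}" using A(2) False by blast
      show ?thesis unfolding c e using False by simp
    qed
  qed
  also have "\<dots> = K * measure lebesgue S"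
    using lmeasure_integral_UNIV[OF S] by simp
  finally show ?thesis .
qed

text \<open>The part of the l^1 ball of radius 2 in the nonnegative orthant, which is the standard
  simplex scaled by 2.\<close>

definition corner :: "(real^'n::finite) set" where
  "corner = {x. (\<forall>i. 0 \<le> x $ i) \<and> (\<Sum>i\<in>UNIV. x $ i) \<le> 2}"

lemma corner_eq: "(corner :: (real^'n::finite) set) = (\<lambda>x. 2 *\<^sub>R x + 0) ` (convex hull (insert 0 Basis))"
proof -
  have b: "(Basis :: (real^'n) set) = range (\<lambda>i. axis i 1)" by (auto simp: Basis_vec_def)
  have inj: "inj (\<lambda>i :: 'n. axis i (1 :: real))" by (auto simp: inj_def axis_eq_axis)
  have s: "convex hull (insert 0 Basis) = {x :: real^'n. (\<forall>i. 0 \<le> x $ i) \<and> (\<Sum>i\<in>UNIV. x $ i) \<le> 1}"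
    unfolding std_simplex unfolding b by (simp add: sum.reindex[OF inj] inner_axis)
  show ?thesis
  proof (intro equalityI subsetI)
    fix x :: "real^'n" assume "x \<in> corner"
    then have "(1 / 2) *\<^sub>R x \<in> convex hull (insert 0 Basis)" "x = 2 *\<^sub>R ((1 / 2) *\<^sub>R x) + 0"
      unfolding s corner_def by (auto simp flip: sum_divide_distrib)
    then show "x \<in> (\<lambda>x. 2 *\<^sub>R x + 0) ` (convex hull (insert 0 Basis))" by blast
  next
    fix x :: "real^'n" assume "x \<in> (\<lambda>x. 2 *\<^sub>R x + 0) ` (convex hull (insert 0 Basis))"
    then show "x \<in> corner" unfolding s corner_def by (auto simp flip: sum_distrib_left)
  qed
qed

lemma compact_corner: "compact (corner :: (real^'n::finite) set)"
proof -
  have "compact (convex hull (insert 0 Basis) :: (real^'n) set)"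
    by (intro finite_imp_compact_convex_hull) simp
  then show ?thesis unfolding corner_eq
    by (intro compact_continuous_image continuous_intros)
qed

lemma measure_corner:
  "measure lebesgue (corner :: (real^'n::finite) set) = 2 ^ CARD('n) / fact CARD('n)"
proof -
  have "compact (convex hull (insert 0 Basis) :: (real^'n) set)"
    by (intro finite_imp_compact_convex_hull) simp
  then have "(convex hull (insert 0 Basis) :: (real^'n) set) \<in> sets lborel"
    by (simp add: borel_compact)
  then have "measure lebesgue (convex hull (insert 0 Basis) :: (real^'n) set) = 1 / fact CARD('n)"
    using content_std_simplex[where 'a = "real^'n"] by simp
  then show ?thesis unfolding corner_eq measure_lebesgue_affine by simp
qed

theorem measure_full_root_polytope:
  "measure lebesgue (full_root_polytope :: (real^'n::{finite,wellorder}) set) =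
    real ((2 * CARD('n) - 1) choose CARD('n)) * (2 / fact CARD('n))"
proof -
  let ?P = "full_root_polytope :: (real^'n::_) set"
      and ?G = "signed_permutations :: (('n \<Rightarrow> 'n) \<times> _) set"
  let ?N = "{x :: real^'n::_. \<not> generic x}"
  have finroots: "finite (positive_roots :: (real^'n::_) set)" unfolding positive_roots_eq by simp
  then have cP: "compact ?P" unfolding full_root_polytope_def
      by (intro finite_imp_compact_convex_hull) simp
  have P: "x \<in> ?P \<longleftrightarrow> dominant x \<and> (\<Sum>v\<in>UNIV. \<bar>x $ v\<bar>) \<le> 2" for x
    unfolding full_root_polytope_eq by simp
  have cont: "continuous_on UNIV (signed_permute g)" if "g \<in> ?G" for g
    using orthogonal_signed_permute[OF that]
        by (simp add: linear_continuous_on linear_conv_bounded_linear[symmetric] orthogonal_transformation_linear)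
  have corner_l1: "(\<Sum>i\<in>UNIV. \<bar>x $ i\<bar>) \<le> 2" if "x \<in> corner"
      for x :: "real^'n::_"
    using that unfolding corner_def by simp
  \<comment> \<open>The part of the corner that \<open>g\<close> sends into the polytope. The total
    volume of these parts is computed twice: inside the corner, where a generic point lies in
    (2n-1)!! of them, and after applying each \<open>g\<close>, inside the polytope, where a generic
    point lies in n! images.\<close>
  define C where "C g = corner \<inter> signed_permute g -` ?P"
      for g :: "('n \<Rightarrow> 'n) \<times> ('n \<Rightarrow> real)"
  have Cm: "C g \<in> lmeasurable" if "g \<in> ?G" for g
  proof -
    have "closed (signed_permute g -` ?P)"
      using cont[OF that] compact_imp_closed[OF cP] by (metis closed_vimage)
    then have "compact (C g)" unfolding C_def by (intro compact_Int_closed compact_corner)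
    then show ?thesis by (rule lmeasurable_compact)
  qed
  have 1: "(\<Sum>g\<in>?G. measure lebesgue (C g)) = arrangement_count CARD('n) * measure lebesgue (corner :: (real^'n::_) set)"
  proof (rule sum_measure_eq_count[OF finite_signed_permutations])
    fix x :: "real^'n::_" assume x: "x \<in> corner - ?N"
    then have gen: "generic x" by simp
    have pos: "0 < x $ i" for i
      using x generic_nth_inj(1)[OF gen, of i] unfolding corner_def by (auto simp: order_le_less)
    have "{g \<in> ?G. x \<in> C g} = {g \<in> ?G. dominant (signed_permute g x)}"
      using x corner_l1[of x] signed_permute_l1[of _ x] unfolding C_def P vimage_def by auto
    then show "real (card {g \<in> ?G. x \<in> C g}) = arrangement_count CARD('n)"
      using card_dominant_signed_permutations[OF gen pos] by simp
  qed (use Cm negligible_nongeneric lmeasurable_compact[OF compact_corner] in \<open>auto simp: C_def\<close>)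
  have 2: "(\<Sum>g\<in>?G. measure lebesgue (signed_permute g ` C g)) = fact CARD('n) * measure lebesgue ?P"
  proof (rule sum_measure_eq_count[OF finite_signed_permutations])
    fix x :: "real^'n::_" assume x: "x \<in> ?P - ?N"
    then have gen: "generic x" by simp
    have "x \<in> signed_permute g ` C g \<longleftrightarrow> (\<exists>y. (\<forall>i. 0 \<le> y $ i) \<and> x = signed_permute g y)" if g: "g \<in> ?G" for g
    proof
      assume "\<exists>y. (\<forall>i. 0 \<le> y $ i) \<and> x = signed_permute g y"
      then obtain y where y: "\<And>i. 0 \<le> y $ i" "x = signed_permute g y" by blast
      have "(\<Sum>i\<in>UNIV. \<bar>x $ i\<bar>) \<le> 2" using x P by blast
      then have "(\<Sum>i\<in>UNIV. \<bar>y $ i\<bar>) \<le> 2"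
          using signed_permute_l1[OF g, of y] y(2) by simp
      then have "y \<in> C g" using x y unfolding C_def corner_def by auto
      then show "x \<in> signed_permute g ` C g" using y(2) by blast
    qed (auto simp: C_def corner_def)
    then have "{g \<in> ?G. x \<in> signed_permute g ` C g} =
        {g \<in> ?G. \<exists>y. (\<forall>i. 0 \<le> y $ i) \<and> x = signed_permute g y}" by blast
    then show "real (card {g \<in> ?G. x \<in> signed_permute g ` C g}) = fact CARD('n)"
      using card_orthant_signed_permutations[of x] generic_nth_inj(1)[OF gen] by simp
  next
    show "signed_permute g ` C g \<in> lmeasurable" if "g \<in> ?G" for g
      using measurable_orthogonal_image[OF orthogonal_signed_permute[OF that] Cm[OF that]] .
    show "signed_permute g ` C g \<subseteq> ?P" for g unfolding C_def by blast
  qed (use negligible_nongeneric lmeasurable_compact[OF cP] in auto)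
  have "(\<Sum>g\<in>?G. measure lebesgue (signed_permute g ` C g)) = (\<Sum>g\<in>?G. measure lebesgue (C g))"
    by (intro sum.cong refl measure_orthogonal_image orthogonal_signed_permute Cm)
  then have "fact CARD('n) * measure lebesgue ?P = arrangement_count CARD('n) * (2 ^ CARD('n) / fact CARD('n))"
    unfolding 1 2 measure_corner .
  then have "measure lebesgue ?P = arrangement_count CARD('n) * 2 ^ CARD('n) / (fact CARD('n) * fact CARD('n))"
    by (simp add: field_simps)
  also have "\<dots> = real ((2 * CARD('n)) choose CARD('n)) / fact CARD('n)"
  proof -
    have "(4 :: real) ^ CARD('n) = 2 ^ CARD('n) * 2 ^ CARD('n)" by (simp flip: power_mult_distrib)
    then show ?thesis unfolding arrangement_count_eq by (simp add: field_simps)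
  qed
  \<comment> \<open>Pascal's rule, the two middle entries of an odd row being equal.\<close>
  also have "(2 * CARD('n)) choose CARD('n) = 2 * ((2 * CARD('n) - 1) choose CARD('n))"
  proof -
    obtain m where m: "CARD('n) = Suc m" using not0_implies_Suc[of "CARD('n)"] by auto
    have "(2 * Suc m) choose Suc m = (Suc (2 * m) choose m) + (Suc (2 * m) choose Suc m)" by simp
    also have "Suc (2 * m) choose m = Suc (2 * m) choose Suc m"
      using binomial_symmetric[of m "Suc (2 * m)"] by simp
    finally show ?thesis unfolding m by simp
  qed
  finally show ?thesis by simp
qed

theorem theorem23:
  fixes \<T> :: "'n::{finite,wellorder} sgraph set"
  assumes "\<T> = {T. well_structured UNIV T \<and> alternating T}"
  shows "(\<forall>T \<in> \<T>. int CARD('n) simplex root_polytope T) \<and>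
         central_triangulation (positive_roots :: (real^'n::_) set) \<T> root_polytope \<and>
         measure lebesgue (full_root_polytope :: (real^'n::_) set) =
           real ((2 * CARD('n) - 1) choose CARD('n)) * (2 / fact CARD('n))"
  using well_structured_simplex root_polytope_triangulation[OF assms] measure_full_root_polytope
  unfolding assms by blast

end
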